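(* Let $\omega=(\omega_{ij})$ be the (locally constant) Minkowski metric in dimension $n$, and let $Einstein:\Omega\mapsto E$ be the linear second order differential operator on symmetric covariant $2$-tensors obtained by linearizing the Einstein tensor over $\omega$. Then the Einstein operator is self-adjoint, with a slight abuse of language: after identifying symmetric covariant $2$-tensors with symmetric contravariant $2$-tensor densities by raising and lowering indices with the constant metric $\omega$, the formal adjoint $ad(Einstein)$ coincides with $Einstein$.
   Context: Indices run from $1$ to $n$, repeated indices are summed, $d_i$ denotes the (commuting) derivative with respect to $x^i$, $d_{ij}=d_id_j$, and $(\omega^{ij})$ is the inverse matrix of $(\omega_{ij})$. The perturbation $\Omega=(\Omega_{ij}=\Omega_{ji})$ of the metric is a section of $S_2T^*$, and $tr(\Omega)=\omega^{rs}\Omega_{rs}$. The linearizations over $\omega$ of the Christoffel symbols and of the Riemann tensor are $$\Gamma^k_{ij}=\tfrac12\omega^{kr}(d_i\Omega_{rj}+d_j\Omega_{ir}-d_r\Omega_{ij}),\qquad R^k_{l,ij}=d_i\Gamma^k_{lj}-d_j\Gamma^k_{li}.$$ With the paper's conventions, the linearized Ricci tensor is given by $$2R_{ij}=\omega^{rs}d_{rs}\Omega_{ij}+d_{ij}tr(\Omega)-\omega^{rs}(d_{ri}\Omega_{sj}+d_{rj}\Omega_{si}),$$ and, with $R=\omega^{rs}R_{rs}$, the linearized Einstein tensor is $E_{ij}=R_{ij}-\frac12\omega_{ij}R$, that is $$2E_{ij}=\omega^{rs}d_{rs}\Omega_{ij}+d_{ij}tr(\Omega)-\omega^{rs}(d_{ri}\Omega_{sj}+d_{rj}\Omega_{si})-\omega_{ij}\left(\omega^{rs}d_{rs}tr(\Omega)-\omega^{ru}\omega^{sv}d_{rs}\Omega_{uv}\right).$$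 The formal adjoint is obtained by multiplying by test functions and integrating by parts: for symmetric test functions $\lambda=(\lambda^{ij}=\lambda^{ji})$, $ad(Einstein)$ is the unique differential operator $\lambda\mapsto \sigma=(\sigma^{ij}=\sigma^{ji})$ such that $\lambda^{ij}E_{ij}-\sigma^{ij}\Omega_{ij}$ is a total divergence for all $\lambda,\Omega$, where the sums are over all ordered pairs $(i,j)$ (so off-diagonal terms are counted twice). *)

theory Defs
  imports "HOL-Analysis.Analysis"
begin

definition pd :: "'n::finite \<Rightarrow> (real^'n \<Rightarrow> real) \<Rightarrow> real^'n \<Rightarrow> real" where
  "pd i f x = frechet_derivative f (at x) (axis i 1)"

primrec iter_pd :: "'n::finite list \<Rightarrow> (real^'n \<Rightarrow> real) \<Rightarrow> real^'n \<Rightarrow> real" where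
  "iter_pd [] f = f"
| "iter_pd (i # \<alpha>) f = pd i (iter_pd \<alpha> f)"

(* For open U this is the usual notion of a smooth function on U: every iterated partial
   derivative exists and is Frechet differentiable (hence continuous) at each point of U. *)
definition smooth_on :: "(real^'n::finite) set \<Rightarrow> (real^'n \<Rightarrow> real) \<Rightarrow> bool" where
  "smooth_on U f \<longleftrightarrow> (\<forall>\<alpha>. \<forall>x\<in>U. iter_pd \<alpha> f differentiable (at x))"

(* Smooth symmetric 2-tensor fields on U, given by their components in the coordinates x.
   The same set serves for covariant tensors and for contravariant tensor densities, the
   components of the latter being taken with respect to the coordinate volume element.
   Values outside the open set U are irrelevant. *)
definition sym_fields :: "(real^'n::finite) set \<Rightarrow> (real^'n \<Rightarrow> real^'n^'n) set" where
  "sym_fields U = {\<Omega>. (\<forall>i j. smooth_on U (\<lambda>x. \<Omega> x $ i $ j)) \<and>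
                       (\<forall>x\<in>U. \<forall>i j. \<Omega> x $ i $ j = \<Omega> x $ j $ i)}"

(* Both sign conventions, diag(-1,1,...,1) and diag(1,-1,...,-1), with any of the
   coordinates as time. *)
definition minkowski_metric :: "real^'n::finite^'n \<Rightarrow> bool" where
  "minkowski_metric \<omega> \<longleftrightarrow>
     (\<exists>\<tau>. \<exists>\<epsilon>\<in>{1, -1}. \<omega> = (\<chi> i j. if i \<noteq> j then 0 else if i = \<tau> then - \<epsilon> else \<epsilon>))"

definition tr :: "real^'n::finite^'n \<Rightarrow> (real^'n \<Rightarrow> real^'n^'n) \<Rightarrow> real^'n \<Rightarrow> real" where
  "tr \<omega> \<Omega> x = (\<Sum>r\<in>UNIV. \<Sum>s\<in>UNIV. matrix_inv \<omega> $ r $ s * \<Omega> x $ r $ s)"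

(* The contraction over k of the linearized Riemann tensor
   R^k_{i,jk} = d_j Gamma^k_{ik} - d_k Gamma^k_{ij}, where
   Gamma^k_{ij} = 1/2 omega^{kr} (d_i Omega_{rj} + d_j Omega_{ir} - d_r Omega_{ij}). *)
definition linearized_ricci ::
    "real^'n::finite^'n \<Rightarrow> (real^'n \<Rightarrow> real^'n^'n) \<Rightarrow> real^'n \<Rightarrow> real^'n^'n" where
  "linearized_ricci \<omega> \<Omega> x = (\<chi> i j. 1/2 *
     ((\<Sum>r\<in>UNIV. \<Sum>s\<in>UNIV. matrix_inv \<omega> $ r $ s * pd r (pd s (\<lambda>y. \<Omega> y $ i $ j)) x)
      + pd i (pd j (tr \<omega> \<Omega>)) x
      - (\<Sum>r\<in>UNIV. \<Sum>s\<in>UNIV. matrix_inv \<omega> $ r $ s *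
           (pd r (pd i (\<lambda>y. \<Omega> y $ s $ j)) x + pd r (pd j (\<lambda>y. \<Omega> y $ s $ i)) x))))"

definition linearized_einstein ::
    "real^'n::finite^'n \<Rightarrow> (real^'n \<Rightarrow> real^'n^'n) \<Rightarrow> real^'n \<Rightarrow> real^'n^'n" where
  "linearized_einstein \<omega> \<Omega> x =
     (\<chi> i j. linearized_ricci \<omega> \<Omega> x $ i $ j - 1/2 * \<omega> $ i $ j * tr \<omega> (linearized_ricci \<omega> \<Omega>) x)"

definition lower_indices ::
    "real^'n::finite^'n \<Rightarrow> (real^'n \<Rightarrow> real^'n^'n) \<Rightarrow> real^'n \<Rightarrow> real^'n^'n" where
  "lower_indices \<omega> \<Lambda> x =
     (\<chi> i j. \<Sum>r\<in>UNIV. \<Sum>s\<in>UNIV. \<omega> $ i $ r * \<omega> $ j $ s * \<Lambda> x $ r $ s)"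

(* No determinant factor is needed to land in tensor densities, since
   sqrt |det omega| = 1 for the Minkowski metric. *)
definition raise_indices ::
    "real^'n::finite^'n \<Rightarrow> (real^'n \<Rightarrow> real^'n^'n) \<Rightarrow> real^'n \<Rightarrow> real^'n^'n" where
  "raise_indices \<omega> \<Omega> x =
     (\<chi> i j. \<Sum>r\<in>UNIV. \<Sum>s\<in>UNIV. matrix_inv \<omega> $ i $ r * matrix_inv \<omega> $ j $ s * \<Omega> x $ r $ s)"

(* Linear differential operators of arbitrary finite order with smooth coefficients on U.
   Words over the index type stand for multi-indices; as derivatives commute, the redundancy
   does not change which operators are representable. *)
definition differential_operator ::
    "(real^'n::finite) set \<Rightarrow> ((real^'n \<Rightarrow> real^'n^'n) \<Rightarrow> real^'n \<Rightarrow> real^'n^'n) \<Rightarrow> bool" where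
  "differential_operator U Q \<longleftrightarrow>
     (\<forall>\<Lambda>\<in>sym_fields U. Q \<Lambda> \<in> sym_fields U) \<and>
     (\<exists>m a. (\<forall>\<alpha> i j k l. smooth_on U (a \<alpha> i j k l)) \<and>
       (\<forall>\<Lambda>\<in>sym_fields U. \<forall>x\<in>U. \<forall>i j.
          Q \<Lambda> x $ i $ j =
            (\<Sum>\<alpha> | length \<alpha> \<le> m. \<Sum>k\<in>UNIV. \<Sum>l\<in>UNIV.
               a \<alpha> i j k l x * iter_pd \<alpha> (\<lambda>y. \<Lambda> y $ k $ l) x)))"

(* Bilinear expressions in finitely many derivatives of two fields, with smooth coefficients. *)
definition bidifferential_operator ::
    "(real^'n::finite) set \<Rightarrow>
     ((real^'n \<Rightarrow> real^'n^'n) \<Rightarrow> (real^'n \<Rightarrow> real^'n^'n) \<Rightarrow> real^'n \<Rightarrow> real) \<Rightarrow> bool" where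
  "bidifferential_operator U B \<longleftrightarrow>
     (\<exists>m b. (\<forall>\<alpha> \<beta> i j k l. smooth_on U (b \<alpha> \<beta> i j k l)) \<and>
       (\<forall>\<Lambda>\<in>sym_fields U. \<forall>\<Omega>\<in>sym_fields U. \<forall>x\<in>U.
          B \<Lambda> \<Omega> x =
            (\<Sum>\<alpha> | length \<alpha> \<le> m. \<Sum>\<beta> | length \<beta> \<le> m.
             \<Sum>i\<in>UNIV. \<Sum>j\<in>UNIV. \<Sum>k\<in>UNIV. \<Sum>l\<in>UNIV.
               b \<alpha> \<beta> i j k l x * iter_pd \<alpha> (\<lambda>y. \<Lambda> y $ i $ j) x
                             * iter_pd \<beta> (\<lambda>y. \<Omega> y $ k $ l) x)))"

(* The vector field must depend on the two fields through their derivatives: without this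
   requirement every smooth function on R^n would be a divergence. *)
definition total_divergence ::
    "(real^'n::finite) set \<Rightarrow>
     ((real^'n \<Rightarrow> real^'n^'n) \<Rightarrow> (real^'n \<Rightarrow> real^'n^'n) \<Rightarrow> real^'n \<Rightarrow> real) \<Rightarrow> bool" where
  "total_divergence U F \<longleftrightarrow>
     (\<exists>V. (\<forall>r. bidifferential_operator U (V r)) \<and>
       (\<forall>\<Lambda>\<in>sym_fields U. \<forall>\<Omega>\<in>sym_fields U. \<forall>x\<in>U.
          F \<Lambda> \<Omega> x = (\<Sum>r\<in>UNIV. pd r (V r \<Lambda> \<Omega>) x)))"

(* The last conjunct only fixes the meaningless values of Q (arguments that are not fields
   on U, points outside U), so that the adjoint is unique as a HOL function. *)
definition is_formal_adjoint ::
    "(real^'n::finite) set \<Rightarrow>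
     ((real^'n \<Rightarrow> real^'n^'n) \<Rightarrow> real^'n \<Rightarrow> real^'n^'n) \<Rightarrow>
     ((real^'n \<Rightarrow> real^'n^'n) \<Rightarrow> real^'n \<Rightarrow> real^'n^'n) \<Rightarrow> bool" where
  "is_formal_adjoint U P Q \<longleftrightarrow>
     differential_operator U Q \<and>
     total_divergence U (\<lambda>\<Lambda> \<Omega> x. (\<Sum>i\<in>UNIV. \<Sum>j\<in>UNIV. \<Lambda> x $ i $ j * P \<Omega> x $ i $ j)
                                - (\<Sum>i\<in>UNIV. \<Sum>j\<in>UNIV. Q \<Lambda> x $ i $ j * \<Omega> x $ i $ j)) \<and>
     (\<forall>\<Lambda> x. \<Lambda> \<notin> sym_fields U \<or> x \<notin> U \<longrightarrow> Q \<Lambda> x = 0)"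

definition formal_adjoint ::
    "(real^'n::finite) set \<Rightarrow>
     ((real^'n \<Rightarrow> real^'n^'n) \<Rightarrow> real^'n \<Rightarrow> real^'n^'n) \<Rightarrow>
     ((real^'n \<Rightarrow> real^'n^'n) \<Rightarrow> real^'n \<Rightarrow> real^'n^'n)" where
  "formal_adjoint U P = (THE Q. is_formal_adjoint U P Q)"

end

theory Submission
  imports Defs
begin

text \<open>
  Self-adjointness. Let W be the inverse of \<omega>. With its free indices raised, the linearized
  Einstein tensor is a sum of terms C(i,j,r,s,k,l) d_r d_s \<Omega>_{kl} with constants C that are
  polynomials in W. Since \<Omega> is symmetric, these constants can be chosen such that
  C(i,j,r,s,k,l) = C(k,l,s,r,i,j): the terms of the Einstein tensor are either invariant under this
  exchange, or form a pair, namely the Hessian of the trace of \<Omega> and the double divergence of \<Omega>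
  multiplied by \<omega> (einstein_symbol_transpose). Integrating by parts twice transfers both
  derivatives to the test field and applies precisely this exchange to the constants
  (total_divergence_second_order). So the operator obtained by lowering the indices of the test
  field, applying the Einstein operator and raising the indices of the result is a formal adjoint;
  that its values are symmetric again uses that second derivatives commute (pd_commute).

  Uniqueness. The pairing of the difference of two formal adjoints with \<Omega> is the divergence of a
  vector field V that depends on \<Omega> through its derivatives of order at most some m. Take \<Omega> = q^N S
  with a constant symmetric matrix S and the polynomial q(x) = R^2 - |x - c|^2. For N \<ge> m + 2 the
  field V is divisible by q^2, hence its extension by zero from the ball is continuously
  differentiable and the integral of its divergence over the ball vanishes
  (total_divergence_ball_bump). So the integral of q^N times the pairing of the difference with S
  is zero on every small ball around c, and the pairing vanishes at c by continuity
  (eq_0_if_ball_bump_integrals_vanish). Choosing for S the difference at c itself shows that this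
  difference is zero (is_formal_adjoint_unique). The symmetry of second derivatives is obtained
  from the same two facts about q.
\<close>

section \<open>Partial derivatives\<close>

lemma pd_eqI: "(f has_derivative f') (at x) \<Longrightarrow> pd i f x = f' (axis i 1)"
  by (metis frechet_derivative_at pd_def)

lemma pd_const [simp]: "pd i (\<lambda>x. c) x = 0"
  by (simp add: pd_def)

lemma pd_add:
  assumes "f differentiable at x" "g differentiable at x"
  shows "pd i (\<lambda>y. f y + g y) x = pd i f x + pd i g x"
  by (rule pd_eqI[OF has_derivative_add[OF assms[unfolded frechet_derivative_works]],
        folded pd_def])

lemma pd_diff:
  assumes "f differentiable at x" "g differentiable at x"
  shows "pd i (\<lambda>y. f y - g y) x = pd i f x - pd i g x"
  by (rule pd_eqI[OF has_derivative_diff[OF assms[unfolded frechet_derivative_works]],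
        folded pd_def])

lemma pd_mult:
  assumes "f differentiable at x" "g differentiable at x"
  shows "pd i (\<lambda>y. f y * g y) x = f x * pd i g x + pd i f x * g x"
  by (rule pd_eqI[OF has_derivative_mult[OF assms[unfolded frechet_derivative_works]],
        folded pd_def])

lemma pd_cmult:
  assumes "f differentiable at x"
  shows "pd i (\<lambda>y. c * f y) x = c * pd i f x"
  using pd_mult[of "\<lambda>_. c" x f i] assms by simp

lemma pd_sum:
  assumes "\<And>a. a \<in> A \<Longrightarrow> f a differentiable at x"
  shows "pd i (\<lambda>y. \<Sum>a\<in>A. f a y) x = (\<Sum>a\<in>A. pd i (f a) x)"
proof -
  have "((\<lambda>y. \<Sum>a\<in>A. f a y) has_derivative
      (\<lambda>h. \<Sum>a\<in>A. frechet_derivative (f a) (at x) h)) (at x)"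
    using assms by (intro has_derivative_sum) (simp add: frechet_derivative_works)
  from pd_eqI[OF this] show ?thesis by (simp add: pd_def)
qed

lemma pd_power:
  assumes "f differentiable at x"
  shows "pd i (\<lambda>y. f y ^ n) x = of_nat n * f x ^ (n - 1) * pd i f x"
  by (subst pd_eqI[OF has_derivative_power[OF assms[unfolded frechet_derivative_works]]])
    (simp add: pd_def)

lemma pd_coordinate: "pd i (\<lambda>y. y $ j) x = (if i = j then 1 else 0)"
  by (subst pd_eqI[OF bounded_linear_imp_has_derivative[OF bounded_linear_vec_nth]])
    (auto simp: axis_def)

lemma has_derivative_cong_open:
  assumes "open U" "x \<in> U" "\<And>y. y \<in> U \<Longrightarrow> f y = g y"
  shows "(f has_derivative f') (at x) \<longleftrightarrow> (g has_derivative f') (at x)"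
  using has_derivative_transform_within_open[of f f' x UNIV U g]
    has_derivative_transform_within_open[of g f' x UNIV U f] assms by auto

lemma differentiable_cong_open:
  assumes "open U" "x \<in> U" "\<And>y. y \<in> U \<Longrightarrow> f y = g y"
  shows "f differentiable at x \<longleftrightarrow> g differentiable at x"
  unfolding differentiable_def by (simp only: has_derivative_cong_open[OF assms])

lemma pd_cong_open:
  assumes "open U" "x \<in> U" "\<And>y. y \<in> U \<Longrightarrow> f y = g y"
  shows "pd i f x = pd i g x"
  unfolding pd_def frechet_derivative_def by (simp only: has_derivative_cong_open[OF assms])

lemma iter_pd_cong_open:
  assumes "open U" "x \<in> U" "\<And>y. y \<in> U \<Longrightarrow> f y = g y"
  shows "iter_pd \<alpha> f x = iter_pd \<alpha> g x"
  using \<open>x \<in> U\<close> by (induction \<alpha> arbitrary: x) (auto intro: assms pd_cong_open)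

lemma iter_pd_append: "iter_pd (\<alpha> @ \<beta>) f = iter_pd \<alpha> (iter_pd \<beta> f)"
  by (induction \<alpha>) auto

section \<open>Smooth functions\<close>

lemma smooth_on_cong:
  assumes "open U" "\<And>y. y \<in> U \<Longrightarrow> f y = g y"
  shows "smooth_on U f \<longleftrightarrow> smooth_on U g"
proof -
  have "iter_pd \<alpha> f differentiable at x \<longleftrightarrow> iter_pd \<alpha> g differentiable at x" if "x \<in> U" for \<alpha> x
    using iter_pd_cong_open[OF \<open>open U\<close> _ assms(2)]
    by (intro differentiable_cong_open[OF \<open>open U\<close> that])
  then show ?thesis by (simp add: smooth_on_def)
qed

lemma smooth_on_imp_differentiable: "smooth_on U f \<Longrightarrow> x \<in> U \<Longrightarrow> f differentiable at x"
  unfolding smooth_on_def by (drule spec[of _ "[]"]) simp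

lemma smooth_on_imp_continuous_on: "smooth_on U f \<Longrightarrow> continuous_on U f"
  by (meson continuous_at_imp_continuous_on differentiable_imp_continuous_within
      smooth_on_imp_differentiable)

lemma smooth_on_iter_pd: "smooth_on U f \<Longrightarrow> smooth_on U (iter_pd \<beta> f)"
  by (simp add: smooth_on_def flip: iter_pd_append)

lemma smooth_on_pd: "smooth_on U f \<Longrightarrow> smooth_on U (pd i f)"
  using smooth_on_iter_pd[of U f "[i]"] by simp

text \<open>
  Smoothness is a greatest fixed point: a family of differentiable functions that is closed,
  up to values outside U, under partial derivatives consists of smooth functions. The outermost
  derivative of an iterate is the head of the word, so the induction peels words from the right.
\<close>
lemma smooth_on_coinduct:
  assumes "open U" and "f \<in> S"
    and diff: "\<And>g x. g \<in> S \<Longrightarrow> x \<in> U \<Longrightarrow> g differentiable at x"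
    and step: "\<And>g i. g \<in> S \<Longrightarrow> \<exists>h\<in>S. \<forall>x\<in>U. pd i g x = h x"
  shows "smooth_on U f"
proof -
  have "\<forall>x\<in>U. iter_pd \<alpha> f differentiable at x" for \<alpha>
    using \<open>f \<in> S\<close>
  proof (induction \<alpha> arbitrary: f rule: rev_induct)
    case Nil
    then show ?case by (simp add: diff)
  next
    case (snoc i \<alpha>)
    obtain h where h: "h \<in> S" "\<forall>x\<in>U. pd i f x = h x"
      using step[OF snoc.prems] by blast
    have "iter_pd (\<alpha> @ [i]) f y = iter_pd \<alpha> h y" if "y \<in> U" for y
      using iter_pd_cong_open[OF \<open>open U\<close> that, of "pd i f" h] h by (simp add: iter_pd_append)
    then show ?case
      using snoc.IH[OF h(1)]
      by (simp add: differentiable_cong_open[OF \<open>open U\<close>, of _ "iter_pd (\<alpha> @ [i]) f" "iter_pd \<alpha> h"])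
  qed
  then show ?thesis by (simp add: smooth_on_def)
qed

lemma smooth_on_const [simp]: "open U \<Longrightarrow> smooth_on U (\<lambda>x. c)"
  by (rule smooth_on_coinduct[of U _ "range (\<lambda>c x. c)"]) auto

lemma smooth_on_coordinate: "open U \<Longrightarrow> smooth_on U (\<lambda>x. x $ j)"
  by (rule smooth_on_coinduct[of U _ "insert (\<lambda>x. x $ j) (range (\<lambda>c x. c))"])
    (auto simp: pd_coordinate intro: bounded_linear_imp_differentiable bounded_linear_vec_nth)

text \<open>
  The derivative of a product of smooth functions is a sum of products of smooth functions, so
  closure of smoothness under sums and products follows by coinduction for this larger family.
\<close>
inductive_set smooth_algebra :: "(real^'n::finite) set \<Rightarrow> (real^'n \<Rightarrow> real) set"
  for U where
  base: "smooth_on U f \<Longrightarrow> f \<in> smooth_algebra U"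
| add: "f \<in> smooth_algebra U \<Longrightarrow> g \<in> smooth_algebra U \<Longrightarrow> (\<lambda>x. f x + g x) \<in> smooth_algebra U"
| mult: "f \<in> smooth_algebra U \<Longrightarrow> g \<in> smooth_algebra U \<Longrightarrow> (\<lambda>x. f x * g x) \<in> smooth_algebra U"

lemma smooth_on_smooth_algebra:
  assumes "open U" "f \<in> smooth_algebra U"
  shows "smooth_on U f"
proof (rule smooth_on_coinduct[OF assms])
  show diff: "g differentiable at x" if "g \<in> smooth_algebra U" "x \<in> U" for g x
    using that by induction (auto intro: smooth_on_imp_differentiable)
  show "\<exists>h\<in>smooth_algebra U. \<forall>x\<in>U. pd i g x = h x" if "g \<in> smooth_algebra U" for g i
    using that
  proof induction
    case (base f)
    then show ?case
      by (intro bexI[of _ "pd i f"] smooth_algebra.base smooth_on_pd) auto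
  next
    case (add f g)
    obtain f' g' where "f' \<in> smooth_algebra U" "g' \<in> smooth_algebra U"
      and "\<forall>x\<in>U. pd i f x = f' x" "\<forall>x\<in>U. pd i g x = g' x"
      using add.IH by blast
    then show ?case
      by (intro bexI[of _ "\<lambda>x. f' x + g' x"] smooth_algebra.add)
        (simp_all add: pd_add diff add.hyps)
  next
    case (mult f g)
    obtain f' g' where "f' \<in> smooth_algebra U" "g' \<in> smooth_algebra U"
      and "\<forall>x\<in>U. pd i f x = f' x" "\<forall>x\<in>U. pd i g x = g' x"
      using mult.IH by blast
    then show ?case
      by (intro bexI[of _ "\<lambda>x. f x * g' x + f' x * g x"] smooth_algebra.add smooth_algebra.mult)
        (simp_all add: pd_mult diff mult.hyps)
  qed
qed

lemma smooth_on_add: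
  "open U \<Longrightarrow> smooth_on U f \<Longrightarrow> smooth_on U g \<Longrightarrow> smooth_on U (\<lambda>x. f x + g x)"
  by (rule smooth_on_smooth_algebra) (simp_all add: smooth_algebra.base smooth_algebra.add)

lemma smooth_on_mult:
  "open U \<Longrightarrow> smooth_on U f \<Longrightarrow> smooth_on U g \<Longrightarrow> smooth_on U (\<lambda>x. f x * g x)"
  by (rule smooth_on_smooth_algebra) (simp_all add: smooth_algebra.base smooth_algebra.mult)

lemma smooth_on_diff:
  "open U \<Longrightarrow> smooth_on U f \<Longrightarrow> smooth_on U g \<Longrightarrow> smooth_on U (\<lambda>x. f x - g x)"
  using smooth_on_add[of U f "\<lambda>x. - 1 * g x"] smooth_on_mult[of U "\<lambda>x. - 1" g] by simp

lemma smooth_on_power: "open U \<Longrightarrow> smooth_on U f \<Longrightarrow> smooth_on U (\<lambda>x. f x ^ n)"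
  by (induction n) (simp_all add: smooth_on_mult)

lemma smooth_on_sum:
  assumes "open U" "\<And>a. a \<in> A \<Longrightarrow> smooth_on U (f a)"
  shows "smooth_on U (\<lambda>x. \<Sum>a\<in>A. f a x)"
  using assms(2) by (induction A rule: infinite_finite_induct) (simp_all add: assms(1) smooth_on_add)

lemmas smooth_intros = smooth_on_const smooth_on_coordinate smooth_on_add smooth_on_mult
  smooth_on_diff smooth_on_power smooth_on_sum smooth_on_pd smooth_on_iter_pd

section \<open>Integrals of partial derivatives\<close>

lemma has_real_derivative_along_axis:
  fixes G :: "real^'n::finite \<Rightarrow> real"
  assumes "G differentiable at (x + t *\<^sub>R axis r 1)"
  shows "((\<lambda>t. G (x + t *\<^sub>R axis r 1)) has_real_derivative pd r G (x + t *\<^sub>R axis r 1)) (at t)"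
proof -
  let ?y = "x + t *\<^sub>R axis r (1::real)" and ?D = "frechet_derivative G (at (x + t *\<^sub>R axis r 1))"
  have D: "(G has_derivative ?D) (at ?y)"
    using assms by (simp add: frechet_derivative_works)
  have "((\<lambda>t. x + t *\<^sub>R axis r (1::real)) has_derivative (\<lambda>s. s *\<^sub>R axis r 1)) (at t)"
    by (auto intro!: derivative_eq_intros)
  from diff_chain_at[OF this D]
  have "((\<lambda>t. G (x + t *\<^sub>R axis r 1)) has_derivative (\<lambda>s. ?D (s *\<^sub>R axis r 1))) (at t)"
    by (simp add: o_def)
  moreover have "?D (s *\<^sub>R axis r 1) = pd r G ?y * s" for s
    using linear_cmul[OF linear_frechet_derivative[OF assms]] by (simp add: pd_def)
  ultimately show ?thesis
    by (simp add: has_field_derivative_def)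
qed

lemma integral_translation_lborel:
  fixes G :: "'a::euclidean_space \<Rightarrow> real"
  assumes "integrable lborel G"
  shows "integrable lborel (\<lambda>x. G (x + a))"
    and "(LINT x|lborel. G (x + a)) = integral\<^sup>L lborel G"
proof -
  have G: "G \<in> borel_measurable borel"
    using assms by auto
  have *: "distr lborel borel ((+) a) = lborel"
    by (simp add: lborel_distr_plus)
  have "integrable (distr lborel borel ((+) a)) G" using assms by (simp add: *)
  then show "integrable lborel (\<lambda>x. G (x + a))"
    using integrable_distr_eq[of "(+) a" lborel borel G] G by (simp add: add.commute)
  show "(LINT x|lborel. G (x + a)) = integral\<^sup>L lborel G"
    using integral_distr[of "(+) a" lborel borel G] G by (simp add: * add.commute)
qed

lemma integrable_lborel_supported_cball:
  fixes f :: "'a::euclidean_space \<Rightarrow> real"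
  assumes "continuous_on UNIV f" and "\<And>x. x \<notin> cball c R \<Longrightarrow> f x = 0"
  shows "integrable lborel f"
proof -
  have "integrable lborel (\<lambda>x. indicator (cball c R) x *\<^sub>R f x)"
    by (rule borel_integrable_compact)
      (use assms(1) continuous_on_subset in auto)
  moreover have "(\<lambda>x. indicator (cball c R) x *\<^sub>R f x) = f"
    using assms(2) by (auto simp: indicator_def fun_eq_iff simp del: mem_cball)
  ultimately show ?thesis by simp
qed

text \<open>
  The divergence theorem for a field with compact support, one component at a time. The integral
  of a difference quotient in the direction of the axis vanishes by translation invariance; the
  quotients converge to the partial derivative and are dominated, by the mean value theorem, by a
  multiple of the indicator of a slightly larger ball.
\<close>
lemma integral_pd_eq_0:
  fixes G :: "real^'n::finite \<Rightarrow> real"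
  assumes diff: "\<And>x. G differentiable at x"
    and cont: "continuous_on UNIV (pd r G)"
    and supp: "\<And>x. x \<notin> cball c R \<Longrightarrow> G x = 0"
  shows "integrable lborel (pd r G)" and "integral\<^sup>L lborel (pd r G) = 0"
proof -
  let ?e = "axis r (1::real)" and ?g = "pd r G"
  have supp_pd: "?g x = 0" if "x \<notin> cball c R" for x
    using pd_cong_open[of "- cball c R" x G "\<lambda>_. 0" r] that supp
    by (auto simp del: mem_cball)
  have "bounded (?g ` cball c R)"
    using cont continuous_on_subset compact_continuous_image compact_imp_bounded
    by (metis compact_cball subset_UNIV)
  then obtain C where C: "C > 0" "\<And>x. x \<in> cball c R \<Longrightarrow> \<bar>?g x\<bar> \<le> C"
    by (auto simp: bounded_pos simp del: mem_cball)
  have bound: "\<bar>?g x\<bar> \<le> C" for x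
    using C supp_pd[of x] by (cases "x \<in> cball c R") auto
  have "continuous_on UNIV G"
    using diff by (meson continuous_at_imp_continuous_on differentiable_imp_continuous_within)
  then have intG: "integrable lborel G"
    using supp by (rule integrable_lborel_supported_cball)
  show intg: "integrable lborel ?g"
    using cont supp_pd by (rule integrable_lborel_supported_cball)
  define h where "h = (\<lambda>k. inverse (real (Suc k)))"
  have h: "0 < h k" "h k \<le> 1" for k
    by (auto simp: h_def field_simps)
  define \<phi> where "\<phi> = (\<lambda>k x. (G (x + h k *\<^sub>R ?e) - G x) / h k)"
  have line: "((\<lambda>t. G (x + t *\<^sub>R ?e)) has_real_derivative ?g (x + t *\<^sub>R ?e)) (at t)" for x t
    by (rule has_real_derivative_along_axis[OF diff])
  have int\<phi>: "integrable lborel (\<phi> k)" for k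
    unfolding \<phi>_def by (intro integrable_divide Bochner_Integration.integrable_diff integral_translation_lborel intG)
  have zero: "integral\<^sup>L lborel (\<phi> k) = 0" for k
    unfolding \<phi>_def using intG by (simp add: integral_translation_lborel)
  have dom: "\<bar>\<phi> k x\<bar> \<le> C * indicator (cball c (R + 1)) x" for k x
  proof (cases "x \<in> cball c (R + 1)")
    case True
    obtain z where "G (x + h k *\<^sub>R ?e) - G (x + 0 *\<^sub>R ?e) = (h k - 0) * ?g (x + z *\<^sub>R ?e)"
      using MVT2[of 0 "h k" "\<lambda>t. G (x + t *\<^sub>R ?e)" "\<lambda>t. ?g (x + t *\<^sub>R ?e)"] h line by blast
    then have "\<phi> k x = ?g (x + z *\<^sub>R ?e)"
      using h(1)[of k] by (simp add: \<phi>_def)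
    then show ?thesis using bound True by simp
  next
    case False
    have "dist c x \<le> dist c (x + h k *\<^sub>R ?e) + dist (x + h k *\<^sub>R ?e) x"
      by (rule dist_triangle)
    also have "dist (x + h k *\<^sub>R ?e) x = h k"
      using h(1)[of k] by (simp add: dist_norm)
    finally have "x + h k *\<^sub>R ?e \<notin> cball c R" "x \<notin> cball c R"
      using False h[of k] by auto
    then show ?thesis using \<open>C > 0\<close> by (simp add: \<phi>_def supp del: mem_cball)
  qed
  have lim: "(\<lambda>k. \<phi> k x) \<longlonglongrightarrow> ?g x" for x
  proof -
    have "((\<lambda>t. (G (x + t *\<^sub>R ?e) - G x) / t) \<longlongrightarrow> ?g x) (at 0)"
      using line[of x 0] by (simp add: has_field_derivative_iff)
    moreover have "filterlim h (at 0) sequentially"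
      unfolding filterlim_at using LIMSEQ_inverse_real_of_nat h
      by (auto simp: h_def)
    ultimately show ?thesis
      unfolding \<phi>_def by (rule filterlim_compose)
  qed
  have "(\<lambda>k. integral\<^sup>L lborel (\<phi> k)) \<longlonglongrightarrow> integral\<^sup>L lborel ?g"
  proof (rule integral_dominated_convergence[where w = "\<lambda>x. C * indicator (cball c (R + 1)) x"])
    show "?g \<in> borel_measurable lborel" "\<And>k. \<phi> k \<in> borel_measurable lborel"
      using intg int\<phi> by auto
    show "integrable lborel (\<lambda>x. C * indicator (cball c (R + 1)) x :: real)"
      by (intro integrable_mult_right integrable_real_indicator)
        (simp_all add: emeasure_bounded_finite[OF bounded_cball, unfolded infinity_ennreal_def] )
  qed (use dom lim in auto)
  then show "integral\<^sup>L lborel ?g = 0"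
    by (simp add: zero LIMSEQ_const_iff)
qed

section \<open>Polynomial bumps and the fundamental lemma\<close>

text \<open>
  A polynomial that is positive inside the sphere of radius R about c and vanishes on it. Its
  powers replace the usual smooth functions of compact support: on the sphere they are flat only
  to finite order, but a differential operator of finite order sees no more than that.
\<close>
definition ball_bump :: "real^'n::finite \<Rightarrow> real \<Rightarrow> real^'n \<Rightarrow> real" where
  "ball_bump c R x = R\<^sup>2 - (\<Sum>i\<in>UNIV. (x $ i - c $ i)\<^sup>2)"

lemma ball_bump_eq_dist: "ball_bump c R x = R\<^sup>2 - (dist c x)\<^sup>2"
  by (simp add: ball_bump_def dist_vec_def L2_set_def sum_nonneg dist_real_def power2_commute)

lemma smooth_on_ball_bump: "open U \<Longrightarrow> smooth_on U (ball_bump c R)"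
  unfolding ball_bump_def by (intro smooth_intros)

lemma pd_ball_bump: "pd i (ball_bump c R) x = - 2 * (x $ i - c $ i)"
proof -
  have d: "(\<lambda>y. y $ j) differentiable at x" for j
    by (intro bounded_linear_imp_differentiable bounded_linear_vec_nth)
  have "pd i (ball_bump c R) x = - (\<Sum>j\<in>UNIV. 2 * (x $ j - c $ j) * (if i = j then 1 else 0))"
    unfolding ball_bump_def
    by (subst pd_diff pd_sum pd_power; simp add: d pd_sum pd_power pd_diff pd_coordinate)+
  then show ?thesis by (simp add: if_distrib cong: if_cong)
qed

lemma has_real_derivative_max_0_square:
  "((\<lambda>t::real. (max 0 t)\<^sup>2) has_real_derivative 2 * max 0 t) (at t)"
proof (cases t "0::real" rule: linorder_cases)
  case less
  have "((\<lambda>t. 0) has_real_derivative 2 * max 0 t) (at t)"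
    using less by simp
  then show ?thesis
    by (rule has_field_derivative_transform_within_open[of _ _ _ "{..<0}"]) (use less in auto)
next
  case equal
  have "(\<lambda>h::real. (max 0 h)\<^sup>2 / h) \<midarrow>0\<rightarrow> 0"
  proof (rule Lim_null_comparison[of _ "\<lambda>h. \<bar>h\<bar>"])
    have "norm ((max 0 h)\<^sup>2 / h) \<le> \<bar>h\<bar>" for h :: real
      by (auto simp: max_def power2_eq_square)
    then show "\<forall>\<^sub>F h in at 0. norm ((max 0 h)\<^sup>2 / h) \<le> \<bar>h\<bar>" for h :: real
      by simp
    show "(\<lambda>h::real. \<bar>h\<bar>) \<midarrow>0\<rightarrow> 0"
      by (rule tendsto_rabs_zero) (rule tendsto_ident_at)
  qed
  then show ?thesis using equal by (simp add: has_field_derivative_iff)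
next
  case greater
  have "((\<lambda>t. t\<^sup>2) has_real_derivative 2 * max 0 t) (at t)"
    using greater by (auto intro!: derivative_eq_intros)
  then show ?thesis
    by (rule has_field_derivative_transform_within_open[of _ _ _ "{0<..}"]) (use greater in auto)
qed

text \<open>
  The second power of the bump makes the field and its first derivatives vanish on the sphere, so
  that its extension by zero is continuously differentiable on the whole space. The extension is
  written with the square of the positive part of the bump, which avoids a separate argument for
  points of the sphere.
\<close>
lemma has_integral_pd_ball_bump:
  assumes "open U" "0 \<le> R" "cball c R \<subseteq> U" "smooth_on U F"
  shows "(pd r (\<lambda>x. (ball_bump c R x)\<^sup>2 * F x) has_integral 0) (cball c R)"
proof -
  let ?q = "ball_bump c R"
  have q_diff: "?q differentiable at x" for x
    using smooth_on_ball_bump[of UNIV] smooth_on_imp_differentiable by blast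
  have q_cont: "continuous_on A ?q" for A
    using smooth_on_ball_bump[of UNIV] smooth_on_imp_continuous_on continuous_on_subset by blast
  have q_nonneg: "0 \<le> ?q x \<longleftrightarrow> x \<in> cball c R" for x
    using \<open>0 \<le> R\<close> by (simp add: ball_bump_eq_dist abs_le_square_iff[symmetric])
  \<comment> \<open>the extension by zero; outside the ball the positive part already vanishes\<close>
  define G where "G = (\<lambda>x. if x \<in> U then (max 0 (?q x))\<^sup>2 * F x else 0)"
  have supp: "G x = 0" if "x \<notin> cball c R" for x
    using that q_nonneg[of x] by (simp add: G_def max_def)
  have max_deriv: "((\<lambda>x. (max 0 (?q x))\<^sup>2) has_derivative
      (\<lambda>h. 2 * max 0 (?q x) * frechet_derivative ?q (at x) h)) (at x)" for x
    using diff_chain_at[OF q_diff[unfolded frechet_derivative_works]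
        has_real_derivative_max_0_square[unfolded has_field_derivative_def], of x]
    by (simp add: o_def)
  have F_diff: "F differentiable at x" if "x \<in> U" for x
    using assms(4) that by (rule smooth_on_imp_differentiable)
  have m_diff: "(\<lambda>x. (max 0 (?q x))\<^sup>2) differentiable at x" for x
    using max_deriv differentiableI by blast
  have pdG: "pd i G x = (max 0 (?q x))\<^sup>2 * pd i F x + 2 * max 0 (?q x) * pd i ?q x * F x"
    if "x \<in> U" for i x
  proof -
    have "pd i G x = pd i (\<lambda>x. (max 0 (?q x))\<^sup>2 * F x) x"
      by (rule pd_cong_open[OF assms(1) that]) (simp add: G_def)
    also have "pd i (\<lambda>x. (max 0 (?q x))\<^sup>2) x = 2 * max 0 (?q x) * pd i ?q x"
      by (subst pd_eqI[OF max_deriv]) (simp add: pd_def)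
    then have "pd i (\<lambda>x. (max 0 (?q x))\<^sup>2 * F x) x =
        (max 0 (?q x))\<^sup>2 * pd i F x + 2 * max 0 (?q x) * pd i ?q x * F x"
      by (simp add: pd_mult m_diff F_diff that)
    finally show ?thesis .
  qed
  have pdG0: "pd i G x = 0" if "x \<notin> cball c R" for i x
    using pd_cong_open[of "- cball c R" x G "\<lambda>_. 0" i] that supp by (auto simp del: mem_cball)
  have cover: "U \<union> - cball c R = UNIV" using assms(3) by auto
  have diff: "G differentiable at x" for x
  proof (cases "x \<in> U")
    case True
    have "(\<lambda>x. (max 0 (?q x))\<^sup>2 * F x) differentiable at x"
      using m_diff F_diff[OF True] by (rule differentiable_mult)
    then show ?thesis
      using differentiable_cong_open[OF assms(1) True, of G "\<lambda>x. (max 0 (?q x))\<^sup>2 * F x"]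
      by (simp add: G_def)
  next
    case False
    then have "x \<in> - cball c R" using cover by auto
    then show ?thesis
      using differentiable_cong_open[of "- cball c R" x G "\<lambda>_. 0"] supp
      by (auto simp del: mem_cball)
  qed
  have "continuous_on U (pd r G)"
  proof (rule continuous_on_eq)
    show "continuous_on U
        (\<lambda>x. (max 0 (?q x))\<^sup>2 * pd r F x + 2 * max 0 (?q x) * pd r ?q x * F x)"
      by (intro continuous_intros q_cont smooth_on_imp_continuous_on smooth_on_pd
          smooth_on_ball_bump assms)
  qed (simp add: pdG)
  moreover have "continuous_on (- cball c R) (pd r G)"
    by (rule continuous_on_eq[of _ "\<lambda>_. 0"]) (use pdG0 in auto)
  ultimately have cont: "continuous_on UNIV (pd r G)"
    using continuous_on_open_Un[OF assms(1), of "- cball c R" "pd r G"] cover by (simp add: open_Compl)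
  have "(pd r G has_integral 0) UNIV"
    using has_integral_integral_lborel[OF integral_pd_eq_0(1)[OF diff cont supp]]
      integral_pd_eq_0(2)[OF diff cont supp] by simp
  moreover have "pd r G = (\<lambda>x. if x \<in> cball c R then pd r G x else 0)"
    by (auto simp: pdG0 simp del: mem_cball)
  ultimately have "(pd r G has_integral 0) (cball c R)"
    by (metis has_integral_restrict_UNIV)
  moreover have "pd r G x = pd r (\<lambda>x. (?q x)\<^sup>2 * F x) x" if "x \<in> cball c R" for x
  proof -
    have "x \<in> U" using that assms(3) by auto
    moreover have "max 0 (?q x) = ?q x" using q_nonneg[of x] that by simp
    ultimately show ?thesis
      by (simp add: pdG pd_mult pd_power q_diff F_diff)
  qed
  ultimately show ?thesis by (rule has_integral_eq[rotated])
qed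

text \<open>
  A fundamental lemma of the calculus of variations: if f did not vanish at c, it would have
  constant sign on a small ball around c, where the bump is positive.
\<close>
lemma eq_0_if_ball_bump_integrals_vanish:
  fixes f :: "real^'n::finite \<Rightarrow> real"
  assumes "open U" "continuous_on U f" "c \<in> U"
    and vanish: "\<And>R. 0 < R \<Longrightarrow> cball c R \<subseteq> U \<Longrightarrow>
      \<exists>N. ((\<lambda>x. ball_bump c R x ^ N * f x) has_integral 0) (cball c R)"
  shows "f c = 0"
proof -
  have not_pos: "\<not> 0 < g c"
    if "continuous_on U g" and
      *: "\<And>R. 0 < R \<Longrightarrow> cball c R \<subseteq> U \<Longrightarrow>
        \<exists>N. ((\<lambda>x. ball_bump c R x ^ N * g x) has_integral 0) (cball c R)"
    for g :: "real^'n \<Rightarrow> real"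
  proof
    assume "0 < g c"
    have "open {x \<in> U. 0 < g x}"
    proof -
      have "{x \<in> U. 0 < g x} = U \<inter> g -` {0<..}" by auto
      then show ?thesis
        using continuous_open_preimage[OF that(1) assms(1), of "{0<..}"] by simp
    qed
    moreover have "c \<in> {x \<in> U. 0 < g x}" using \<open>0 < g c\<close> assms(3) by simp
    ultimately obtain R where R: "0 < R" "cball c R \<subseteq> {x \<in> U. 0 < g x}"
      unfolding open_contains_cball by blast
    then obtain N where N: "((\<lambda>x. ball_bump c R x ^ N * g x) has_integral 0) (cball c R)"
      using *[of R] by blast
    let ?p = "\<lambda>x. ball_bump c R x ^ N * g x"
    have nonneg: "0 \<le> ?p x" if "x \<in> cball c R" for x
    proof -
      have "0 \<le> ball_bump c R x"
        using that R(1) by (simp add: ball_bump_eq_dist abs_le_square_iff[symmetric])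
      moreover have "0 < g x" using that R by blast
      ultimately show ?thesis by simp
    qed
    obtain a b where ab: "cbox a b \<subseteq> ball c R" "c \<in> box a b"
      using R(1) by (auto intro: open_contains_cbox[of "ball c R" c])
    then have sub: "cbox a b \<subseteq> cball c R" by auto
    have "continuous_on U ?p"
      by (intro continuous_intros that(1) smooth_on_imp_continuous_on smooth_on_ball_bump assms(1))
    then have cont: "continuous_on (cbox a b) ?p"
      by (rule continuous_on_subset) (use sub R in auto)
    then obtain j where j: "(?p has_integral j) (cbox a b)"
      using integrable_continuous by blast
    have "j \<le> 0"
      by (rule has_integral_subset_le[OF sub j N]) (use nonneg in blast)
    moreover have "0 \<le> j"
      by (rule has_integral_nonneg[OF j]) (use nonneg sub in blast)
    ultimately have "j = 0" by simp
    have "?p c = 0"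
      by (rule has_integral_0_cbox_imp_0[OF cont _ j[unfolded \<open>j = 0\<close>]])
        (use ab nonneg sub box_subset_cbox in blast)+
    moreover have "?p c = R\<^sup>2 ^ N * g c" by (simp add: ball_bump_eq_dist)
    ultimately show False using R(1) \<open>0 < g c\<close> by simp
  qed
  have "\<not> 0 < f c"
    using assms(2) vanish by (rule not_pos)
  moreover have "\<not> 0 < - f c"
  proof (rule not_pos)
    show "continuous_on U (\<lambda>x. - f x)" by (intro continuous_intros assms)
    show "\<exists>N. ((\<lambda>x. ball_bump c R x ^ N * - f x) has_integral 0) (cball c R)"
      if R: "0 < R" "cball c R \<subseteq> U" for R
    proof -
      obtain N where "((\<lambda>x. ball_bump c R x ^ N * f x) has_integral 0) (cball c R)"
        using vanish[OF R] by blast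
      from has_integral_neg[OF this] show ?thesis by auto
    qed
  qed
  ultimately show ?thesis by linarith
qed

text \<open>
  Symmetry of second derivatives. The commutator of d_i and d_j obeys the product rule and
  annihilates the polynomial q^3, where q is the bump; it therefore maps f q^3 to q^3 times its
  value on f. On the other hand, its value on f q^3 is a divergence of multiples of q^2, so that
  its integral over the ball vanishes.
\<close>
lemma pd_commute:
  assumes "open U" "smooth_on U f" "c \<in> U"
  shows "pd i (pd j f) c = pd j (pd i f) c"
proof -
  let ?f = "\<lambda>x. pd i (pd j f) x - pd j (pd i f) x"
  have sm: "smooth_on U f" "smooth_on U (pd i f)" for i
    using assms smooth_on_pd by auto
  have "?f c = 0"
  proof (rule eq_0_if_ball_bump_integrals_vanish[OF assms(1) _ assms(3)])
    show "continuous_on U ?f"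
      by (intro smooth_on_imp_continuous_on smooth_intros assms)
    fix R :: real
    assume R: "0 < R" "cball c R \<subseteq> U"
    let ?q = "ball_bump c R"
    \<comment> \<open>d_i (f q^3) = q^2 F_i\<close>
    let ?F = "\<lambda>i x. ?q x * pd i f x + 3 * f x * pd i ?q x"
    note smq = smooth_on_ball_bump[OF assms(1), of c R]
    have smF: "smooth_on U (?F i)" for i
      by (intro smooth_intros smq assms)
    have "pd i (\<lambda>x. (?q x)\<^sup>2 * ?F j x) x - pd j (\<lambda>x. (?q x)\<^sup>2 * ?F i x) x = ?q x ^ 3 * ?f x"
      if "x \<in> cball c R" for x
    proof -
      have x: "x \<in> U" using that R by auto
      have d: "f differentiable at x" "pd k f differentiable at x" "?q differentiable at x"
        "pd k ?q differentiable at x" for k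
        using sm smq smooth_on_pd x smooth_on_imp_differentiable by blast+
      have pp: "pd k (pd l ?q) x = (if k = l then - 2 else 0)" for k l
      proof -
        have "pd k (pd l ?q) x = pd k (\<lambda>x. - 2 * (x $ l - c $ l)) x"
          by (simp add: pd_ball_bump[abs_def])
        also have "\<dots> = (if k = l then - 2 else 0)"
          by (simp add: pd_cmult pd_diff pd_coordinate
              bounded_linear_imp_differentiable[OF bounded_linear_vec_nth])
        finally show ?thesis .
      qed
      have "pd k (?F l) x = ?q x * pd k (pd l f) x + pd k ?q x * pd l f x
          + 3 * f x * (if k = l then - 2 else 0) + 3 * pd k f x * pd l ?q x" for k l
        by (simp add: pd_add pd_mult pd_cmult d pp)
      moreover have "?F l differentiable at x" for l
        using smF x smooth_on_imp_differentiable by blast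
      ultimately have "pd k (\<lambda>x. (?q x)\<^sup>2 * ?F l x) x =
         (?q x)\<^sup>2 * (?q x * pd k (pd l f) x + pd k ?q x * pd l f x
          + 3 * f x * (if k = l then - 2 else 0) + 3 * pd k f x * pd l ?q x)
         + 2 * ?q x * pd k ?q x * ?F l x" for k l
        by (simp add: pd_mult pd_power d del: pd_add)
      then show ?thesis
        by (simp add: algebra_simps power2_eq_square power3_eq_cube)
    qed
    moreover have "((\<lambda>x. pd i (\<lambda>x. (?q x)\<^sup>2 * ?F j x) x - pd j (\<lambda>x. (?q x)\<^sup>2 * ?F i x) x)
        has_integral 0) (cball c R)"
      using has_integral_diff[OF has_integral_pd_ball_bump[OF assms(1) _ R(2) smF]
          has_integral_pd_ball_bump[OF assms(1) _ R(2) smF]] R(1) by simp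
    ultimately have "((\<lambda>x. ?q x ^ 3 * ?f x) has_integral 0) (cball c R)"
      by (rule has_integral_eq)
    then show "\<exists>N. ((\<lambda>x. ?q x ^ N * ?f x) has_integral 0) (cball c R)" by blast
  qed
  then show ?thesis by simp
qed

section \<open>Uniqueness of formal adjoints\<close>

text \<open>
  Each derivative costs at most one power of the bump.
\<close>
lemma iter_pd_ball_bump_power:
  assumes "length \<beta> \<le> n"
  shows "\<exists>F. smooth_on UNIV F \<and>
    iter_pd \<beta> (\<lambda>y. ball_bump c R y ^ n * s) = (\<lambda>x. ball_bump c R x ^ (n - length \<beta>) * F x)"
  using assms
proof (induction \<beta>)
  case Nil
  then show ?case by (intro exI[of _ "\<lambda>_. s"]) simp
next
  case (Cons i \<beta>)
  let ?q = "ball_bump c R"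
  obtain F where F: "smooth_on UNIV F"
    "iter_pd \<beta> (\<lambda>y. ?q y ^ n * s) = (\<lambda>x. ?q x ^ (n - length \<beta>) * F x)"
    using Cons by auto
  obtain k where k: "n - length \<beta> = Suc k"
    using Cons.prems by (metis Suc_diff_le diff_Suc_Suc length_Cons)
  then have k': "n - length (i # \<beta>) = k" by simp
  have q: "smooth_on UNIV ?q" by (simp add: smooth_on_ball_bump)
  have "pd i (\<lambda>x. ?q x ^ Suc k * F x) x = ?q x ^ k * (?q x * pd i F x + of_nat (Suc k) * pd i ?q x * F x)" for x
  proof -
    have d: "?q differentiable at x" "F differentiable at x"
      using q F(1) smooth_on_imp_differentiable by blast+
    then have "(\<lambda>x. ?q x ^ Suc k) differentiable at x" by (rule_tac differentiable_power)
    from pd_mult[OF this d(2), of i] show ?thesis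
      unfolding pd_power[OF d(1)] by (simp add: algebra_simps)
  qed
  moreover have "smooth_on UNIV (\<lambda>x. ?q x * pd i F x + of_nat (Suc k) * pd i ?q x * F x)"
    by (intro smooth_intros q F open_UNIV)
  ultimately show ?case
    unfolding k' by (intro exI[of _ "\<lambda>x. ?q x * pd i F x + of_nat (Suc k) * pd i ?q x * F x"])
      (simp add: F(2) k fun_eq_iff)
qed

text \<open>
  An operator of order m leaves at least two powers of the bump once N \<ge> m + 2, which is
  what has_integral_pd_ball_bump asks for. The bound depends on the order only, hence it does not
  involve the ball.
\<close>
lemma bidifferential_operator_ball_bump:
  assumes "open U" "bidifferential_operator U B" "\<Lambda> \<in> sym_fields U"
  obtains M where "\<And>N c R S. M \<le> N \<Longrightarrow> (\<lambda>x. ball_bump c R x ^ N *\<^sub>R S) \<in> sym_fields U \<Longrightarrow>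
    \<exists>F. smooth_on U F \<and> (\<forall>x\<in>U. B \<Lambda> (\<lambda>x. ball_bump c R x ^ N *\<^sub>R S) x = (ball_bump c R x)\<^sup>2 * F x)"
proof -
  obtain m b where b: "\<And>\<alpha> \<beta> i j k l. smooth_on U (b \<alpha> \<beta> i j k l)"
    and B: "\<And>\<Lambda> \<Omega> x. \<Lambda> \<in> sym_fields U \<Longrightarrow> \<Omega> \<in> sym_fields U \<Longrightarrow> x \<in> U \<Longrightarrow>
      B \<Lambda> \<Omega> x = (\<Sum>\<alpha> | length \<alpha> \<le> m. \<Sum>\<beta> | length \<beta> \<le> m.
             \<Sum>i\<in>UNIV. \<Sum>j\<in>UNIV. \<Sum>k\<in>UNIV. \<Sum>l\<in>UNIV.
               b \<alpha> \<beta> i j k l x * iter_pd \<alpha> (\<lambda>y. \<Lambda> y $ i $ j) x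
                             * iter_pd \<beta> (\<lambda>y. \<Omega> y $ k $ l) x)"
    using assms(2) unfolding bidifferential_operator_def by blast
  show thesis
  proof (rule that[of "m + 2"])
    fix N c R S
    assume N: "m + 2 \<le> N" and sym: "(\<lambda>x. ball_bump c R x ^ N *\<^sub>R S) \<in> sym_fields U"
    let ?q = "ball_bump c R"
    define F where "F = (\<lambda>\<beta> k l. SOME F. smooth_on UNIV F \<and>
        iter_pd \<beta> (\<lambda>y. ?q y ^ N * S $ k $ l) = (\<lambda>x. ?q x ^ (N - length \<beta>) * F x))"
    have Fex: "smooth_on UNIV (F \<beta> k l) \<and>
        iter_pd \<beta> (\<lambda>y. ?q y ^ N * S $ k $ l) = (\<lambda>x. ?q x ^ (N - length \<beta>) * F \<beta> k l x)"
      if "length \<beta> \<le> m" for \<beta> k l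
      using someI_ex[OF iter_pd_ball_bump_power[of \<beta> N c R "S $ k $ l"]] that N
      unfolding F_def by simp
    note F = Fex[THEN conjunct1] and Feq = Fex[THEN conjunct2]
    have FU: "smooth_on U (F \<beta> k l)" if "length \<beta> \<le> m" for \<beta> k l
      using F[OF that] by (simp add: smooth_on_def)
    define H where "H = (\<lambda>x. \<Sum>\<alpha> | length \<alpha> \<le> m. \<Sum>\<beta> | length \<beta> \<le> m.
             \<Sum>i\<in>UNIV. \<Sum>j\<in>UNIV. \<Sum>k\<in>UNIV. \<Sum>l\<in>UNIV.
               b \<alpha> \<beta> i j k l x * iter_pd \<alpha> (\<lambda>y. \<Lambda> y $ i $ j) x
                             * (?q x ^ (N - length \<beta> - 2) * F \<beta> k l x))"
    have "smooth_on U H"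
      unfolding H_def using assms(3) b
      by (intro smooth_intros FU smooth_on_ball_bump assms(1)) (auto simp: sym_fields_def)
    moreover have "B \<Lambda> (\<lambda>x. ?q x ^ N *\<^sub>R S) x = (?q x)\<^sup>2 * H x" if "x \<in> U" for x
    proof -
      have pow: "?q x ^ (N - length \<beta>) = (?q x)\<^sup>2 * ?q x ^ (N - length \<beta> - 2)" if "length \<beta> \<le> m" for \<beta> :: "'a list"
      proof -
        have "N - length \<beta> = 2 + (N - length \<beta> - 2)" using that N by simp
        then show ?thesis by (metis power_add)
      qed
      have "B \<Lambda> (\<lambda>x. ?q x ^ N *\<^sub>R S) x = (\<Sum>\<alpha> | length \<alpha> \<le> m. \<Sum>\<beta> | length \<beta> \<le> m.
             \<Sum>i\<in>UNIV. \<Sum>j\<in>UNIV. \<Sum>k\<in>UNIV. \<Sum>l\<in>UNIV.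
               (?q x)\<^sup>2 * (b \<alpha> \<beta> i j k l x * iter_pd \<alpha> (\<lambda>y. \<Lambda> y $ i $ j) x
                             * (?q x ^ (N - length \<beta> - 2) * F \<beta> k l x)))"
        unfolding B[OF assms(3) sym that]
        by (intro sum.cong refl) (simp add: Feq pow)
      then show ?thesis by (simp add: H_def sum_distrib_left)
    qed
    ultimately show "\<exists>F. smooth_on U F \<and> (\<forall>x\<in>U. B \<Lambda> (\<lambda>x. ?q x ^ N *\<^sub>R S) x = (?q x)\<^sup>2 * F x)"
      by blast
  qed
qed

lemma total_divergence_ball_bump:
  assumes "open U" "total_divergence U D" "\<Lambda> \<in> sym_fields U"
  obtains M where "\<And>N c R S. M \<le> N \<Longrightarrow> (\<lambda>x. ball_bump c R x ^ N *\<^sub>R S) \<in> sym_fields U \<Longrightarrow>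
    0 \<le> R \<Longrightarrow> cball c R \<subseteq> U \<Longrightarrow>
    (D \<Lambda> (\<lambda>x. ball_bump c R x ^ N *\<^sub>R S) has_integral 0) (cball c R)"
proof -
  obtain V where V: "\<And>r. bidifferential_operator U (V r)"
    and D: "\<And>\<Lambda> \<Omega> x. \<Lambda> \<in> sym_fields U \<Longrightarrow> \<Omega> \<in> sym_fields U \<Longrightarrow> x \<in> U \<Longrightarrow>
      D \<Lambda> \<Omega> x = (\<Sum>r\<in>UNIV. pd r (V r \<Lambda> \<Omega>) x)"
    using assms(2) unfolding total_divergence_def by blast
  have "\<forall>r. \<exists>M. \<forall>N c R S. M \<le> N \<longrightarrow> (\<lambda>x. ball_bump c R x ^ N *\<^sub>R S) \<in> sym_fields U \<longrightarrow>
    (\<exists>F. smooth_on U F \<and> (\<forall>x\<in>U. V r \<Lambda> (\<lambda>x. ball_bump c R x ^ N *\<^sub>R S) x = (ball_bump c R x)\<^sup>2 * F x))"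
    (is "\<forall>r. \<exists>M. ?Q r M")
  proof
    fix r
    show "\<exists>M. ?Q r M"
      by (rule bidifferential_operator_ball_bump[OF assms(1) V assms(3), of r]) blast
  qed
  then obtain M where M: "\<And>r. ?Q r (M r)" by metis
  show thesis
  proof (rule that[of "Max (range M)"])
    fix N c R S
    assume N: "Max (range M) \<le> N" and sym: "(\<lambda>x. ball_bump c R x ^ N *\<^sub>R S) \<in> sym_fields U"
      and R: "0 \<le> R" "cball c R \<subseteq> U"
    let ?\<Omega> = "\<lambda>x. ball_bump c R x ^ N *\<^sub>R S"
    have "(pd r (V r \<Lambda> ?\<Omega>) has_integral 0) (cball c R)" for r
    proof -
      have "M r \<le> N" using N by simp
      then obtain F where F: "smooth_on U F" "\<And>x. x \<in> U \<Longrightarrow> V r \<Lambda> ?\<Omega> x = (ball_bump c R x)\<^sup>2 * F x"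
        using M[of r] sym by blast
      show ?thesis
      proof (rule has_integral_eq[OF _ has_integral_pd_ball_bump[OF assms(1) R F(1)]])
        show "pd r (\<lambda>x. (ball_bump c R x)\<^sup>2 * F x) x = pd r (V r \<Lambda> ?\<Omega>) x" if "x \<in> cball c R" for x
          by (rule pd_cong_open[OF assms(1)]) (use that R F in auto)
      qed
    qed
    then have "((\<lambda>x. \<Sum>r\<in>UNIV. pd r (V r \<Lambda> ?\<Omega>) x) has_integral (\<Sum>r\<in>(UNIV :: 'a set). 0)) (cball c R)"
      by (intro has_integral_sum) auto
    then have "((\<lambda>x. \<Sum>r\<in>UNIV. pd r (V r \<Lambda> ?\<Omega>) x) has_integral 0) (cball c R)" by simp
    then show "(D \<Lambda> ?\<Omega> has_integral 0) (cball c R)"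
      by (rule has_integral_eq[rotated]) (use D[OF assms(3) sym] R in auto)
  qed
qed

text \<open>
  Subtracting the two divergence identities removes the operator P, and what remains is the
  pairing of the difference of the two candidates with the second field. The test field is
  a power of the bump times the constant matrix S, the value of this difference at c; the
  resulting integrand is a power of the bump times a function whose value at c is the sum of
  the squares of the entries of S.
\<close>
lemma is_formal_adjoint_unique:
  assumes "open U" "is_formal_adjoint U P Q" "is_formal_adjoint U P Q'"
  shows "Q = Q'"
proof (intro ext)
  fix \<Lambda> c
  show "Q \<Lambda> c = Q' \<Lambda> c"
  proof (cases "\<Lambda> \<in> sym_fields U \<and> c \<in> U")
    case False
    then show ?thesis using assms(2,3) by (simp add: is_formal_adjoint_def)
  next
    case True
    have QL: "Q \<Lambda> \<in> sym_fields U" "Q' \<Lambda> \<in> sym_fields U"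
      using assms(2,3) True by (simp_all add: is_formal_adjoint_def differential_operator_def)
    define S where "S = Q \<Lambda> c - Q' \<Lambda> c"
    let ?f = "\<lambda>x. \<Sum>i\<in>UNIV. \<Sum>j\<in>UNIV. (Q \<Lambda> x $ i $ j - Q' \<Lambda> x $ i $ j) * S $ i $ j"
    have sym: "(\<lambda>x. ball_bump c R x ^ N *\<^sub>R S) \<in> sym_fields U" for R N
      using QL True
      by (auto simp: sym_fields_def S_def intro!: smooth_intros smooth_on_ball_bump assms(1))
    have "?f c = 0"
    proof (rule eq_0_if_ball_bump_integrals_vanish[OF assms(1)])
      show "continuous_on U ?f"
        using QL by (intro smooth_on_imp_continuous_on smooth_intros assms(1)) (auto simp: sym_fields_def)
      show "c \<in> U" using True by simp
      fix R :: real
      assume R: "0 < R" "cball c R \<subseteq> U"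
      let ?D = "\<lambda>Q \<Lambda> \<Omega> x. (\<Sum>i\<in>UNIV. \<Sum>j\<in>UNIV. \<Lambda> x $ i $ j * P \<Omega> x $ i $ j)
                                - (\<Sum>i\<in>UNIV. \<Sum>j\<in>UNIV. Q \<Lambda> x $ i $ j * \<Omega> x $ i $ j)"
      have td: "total_divergence U (?D Q)" "total_divergence U (?D Q')"
        using assms(2,3) by (simp_all add: is_formal_adjoint_def)
      obtain M where M: "\<And>N c R S. M \<le> N \<Longrightarrow> (\<lambda>x. ball_bump c R x ^ N *\<^sub>R S) \<in> sym_fields U \<Longrightarrow>
          0 \<le> R \<Longrightarrow> cball c R \<subseteq> U \<Longrightarrow> (?D Q \<Lambda> (\<lambda>x. ball_bump c R x ^ N *\<^sub>R S) has_integral 0) (cball c R)"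
        using total_divergence_ball_bump[OF assms(1) td(1), of \<Lambda>] True by blast
      obtain M' where M': "\<And>N c R S. M' \<le> N \<Longrightarrow> (\<lambda>x. ball_bump c R x ^ N *\<^sub>R S) \<in> sym_fields U \<Longrightarrow>
          0 \<le> R \<Longrightarrow> cball c R \<subseteq> U \<Longrightarrow> (?D Q' \<Lambda> (\<lambda>x. ball_bump c R x ^ N *\<^sub>R S) has_integral 0) (cball c R)"
        using total_divergence_ball_bump[OF assms(1) td(2), of \<Lambda>] True by blast
      let ?N = "max M M'"
      let ?\<Omega> = "\<lambda>x. ball_bump c R x ^ ?N *\<^sub>R S"
      have "(?D Q' \<Lambda> ?\<Omega> has_integral 0) (cball c R)" "(?D Q \<Lambda> ?\<Omega> has_integral 0) (cball c R)"
        using M'[OF _ sym _ R(2), of ?N] M[OF _ sym _ R(2), of ?N] R(1) by simp_all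
      then have "((\<lambda>x. ?D Q' \<Lambda> ?\<Omega> x - ?D Q \<Lambda> ?\<Omega> x) has_integral 0 - 0) (cball c R)"
        by (rule has_integral_diff)
      moreover have "?D Q' \<Lambda> ?\<Omega> x - ?D Q \<Lambda> ?\<Omega> x = ball_bump c R x ^ ?N * ?f x" for x
        by (simp add: sum_distrib_left algebra_simps sum_subtractf)
      ultimately have "((\<lambda>x. ball_bump c R x ^ ?N * ?f x) has_integral 0) (cball c R)"
        by simp
      then show "\<exists>N. ((\<lambda>x. ball_bump c R x ^ N * ?f x) has_integral 0) (cball c R)" by blast
    qed
    then have "(\<Sum>i\<in>UNIV. \<Sum>j\<in>UNIV. (S $ i $ j)\<^sup>2) = 0"
      by (simp add: S_def power2_eq_square)
    then have "S $ i $ j = 0" for i j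
      by (simp add: sum_nonneg_eq_0_iff sum_nonneg)
    then have "S = 0" by (simp add: vec_eq_iff)
    then show ?thesis by (simp add: S_def)
  qed
qed

section \<open>Second-order operators with constant coefficients\<close>

definition second_order_operator ::
    "('n::finite \<Rightarrow> 'n \<Rightarrow> 'n \<Rightarrow> 'n \<Rightarrow> 'n \<Rightarrow> 'n \<Rightarrow> real) \<Rightarrow>
     (real^'n \<Rightarrow> real^'n^'n) \<Rightarrow> real^'n \<Rightarrow> real^'n^'n" where
  "second_order_operator A \<Omega> x =
     (\<chi> i j. \<Sum>r\<in>UNIV. \<Sum>s\<in>UNIV. \<Sum>k\<in>UNIV. \<Sum>l\<in>UNIV.
        A i j r s k l * pd r (pd s (\<lambda>y. \<Omega> y $ k $ l)) x)"

lemma smooth_on_sym_fields: "\<Omega> \<in> sym_fields U \<Longrightarrow> smooth_on U (\<lambda>x. \<Omega> x $ i $ j)"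
  by (simp add: sym_fields_def)

lemma smooth_on_second_order_operator:
  assumes "open U" "\<Omega> \<in> sym_fields U"
  shows "smooth_on U (\<lambda>x. second_order_operator A \<Omega> x $ i $ j)"
  unfolding second_order_operator_def vec_lambda_beta
  by (intro smooth_intros assms smooth_on_sym_fields)

lemma finite_words: "finite {\<alpha> :: 'n::finite list. length \<alpha> \<le> m}"
  using finite_lists_length_le[of "UNIV :: 'n set" m] by simp

lemma sum_words_length_le_1:
  fixes f :: "'n::finite list \<Rightarrow> real"
  shows "(\<Sum>\<alpha> | length \<alpha> \<le> 1. f \<alpha>) = f [] + (\<Sum>s\<in>UNIV. f [s])"
proof -
  have "{\<alpha> :: 'n list. length \<alpha> \<le> 1} = insert [] (range (\<lambda>s. [s]))"
    by (auto simp: le_Suc_eq length_Suc_conv)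
  moreover have "(\<Sum>\<alpha>\<in>range (\<lambda>s. [s]). f \<alpha>) = (\<Sum>s\<in>UNIV. f [s])"
    by (subst sum.reindex) (auto simp: inj_on_def)
  ultimately show ?thesis by (simp add: sum.insert_if image_iff)
qed

lemma sum_words_length_2:
  fixes f :: "'n::finite list \<Rightarrow> real"
  assumes "\<And>\<alpha>. length \<alpha> \<noteq> 2 \<Longrightarrow> f \<alpha> = 0"
  shows "(\<Sum>\<alpha> | length \<alpha> \<le> 2. f \<alpha>) = (\<Sum>r\<in>UNIV. \<Sum>s\<in>UNIV. f [r, s])"
proof -
  have "(\<Sum>\<alpha> | length \<alpha> \<le> 2. f \<alpha>) = (\<Sum>\<alpha> | length \<alpha> = 2. f \<alpha>)"
    by (rule sum.mono_neutral_right[OF finite_words]) (auto simp: assms)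
  also have "\<dots> = (\<Sum>(r, s)\<in>UNIV \<times> UNIV. f [r, s])"
    by (rule sum.reindex_bij_witness[of _ "\<lambda>(r, s). [r, s]" "\<lambda>\<alpha>. (\<alpha> ! 0, \<alpha> ! 1)"])
      (auto simp: numeral_2_eq_2 length_Suc_conv)
  finally show ?thesis by (simp add: sum.cartesian_product)
qed

lemma differential_operator_second_order:
  assumes "open U" "\<And>\<Lambda>. \<Lambda> \<in> sym_fields U \<Longrightarrow> Q \<Lambda> \<in> sym_fields U"
    and Q: "\<And>\<Lambda> x. \<Lambda> \<in> sym_fields U \<Longrightarrow> x \<in> U \<Longrightarrow> Q \<Lambda> x = second_order_operator A \<Lambda> x"
  shows "differential_operator U Q"
proof -
  define a where "a = (\<lambda>\<alpha> i j k l (x :: real^'a). case \<alpha> of [r, s] \<Rightarrow> A i j r s k l | _ \<Rightarrow> 0)"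
  have a0: "a \<alpha> i j k l x = 0" if "length \<alpha> \<noteq> 2" for \<alpha> i j k l x
    using that by (auto simp: a_def split: list.split)
  have "smooth_on U (a \<alpha> i j k l)" for \<alpha> i j k l
    unfolding a_def using smooth_on_const[OF assms(1)] by (auto split: list.split)
  moreover have "Q \<Lambda> x $ i $ j =
      (\<Sum>\<alpha> | length \<alpha> \<le> 2. \<Sum>k\<in>UNIV. \<Sum>l\<in>UNIV. a \<alpha> i j k l x * iter_pd \<alpha> (\<lambda>y. \<Lambda> y $ k $ l) x)"
    if "\<Lambda> \<in> sym_fields U" "x \<in> U" for \<Lambda> x i j
    by (subst sum_words_length_2) (simp add: a0, simp add: a_def Q that second_order_operator_def)
  ultimately show ?thesis
    unfolding differential_operator_def using assms(2) by blast
qed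

lemma sum_swap_pairs:
  "(\<Sum>i\<in>A. \<Sum>j\<in>B. \<Sum>r\<in>C. \<Sum>s\<in>D. f i j r s) = (\<Sum>r\<in>C. \<Sum>s\<in>D. \<Sum>i\<in>A. \<Sum>j\<in>B. f i j r s)"
proof -
  have "(\<Sum>i\<in>A. \<Sum>j\<in>B. \<Sum>r\<in>C. \<Sum>s\<in>D. f i j r s) =
      (\<Sum>p\<in>A \<times> B. \<Sum>q\<in>C \<times> D. f (fst p) (snd p) (fst q) (snd q))"
    by (simp add: sum.cartesian_product')
  also have "\<dots> = (\<Sum>q\<in>C \<times> D. \<Sum>p\<in>A \<times> B. f (fst p) (snd p) (fst q) (snd q))"
    by (rule sum.swap)
  finally show ?thesis by (simp add: sum.cartesian_product')
qed

text \<open>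
  Integration by parts for constant coefficients,
  \<lambda> d_r d_s \<Omega> - (d_s d_r \<lambda>) \<Omega> = d_r (\<lambda> d_s \<Omega>) - d_s ((d_r \<lambda>) \<Omega>).
  The formal adjoint has the array of coefficients in which the two pairs of tensor indices are
  exchanged and the order of the derivatives is reversed.
\<close>
lemma total_divergence_second_order:
  assumes "open U"
    and P: "\<And>\<Omega> x. \<Omega> \<in> sym_fields U \<Longrightarrow> x \<in> U \<Longrightarrow> P \<Omega> x = second_order_operator A \<Omega> x"
    and Q: "\<And>\<Lambda> x. \<Lambda> \<in> sym_fields U \<Longrightarrow> x \<in> U \<Longrightarrow>
      Q \<Lambda> x = second_order_operator (\<lambda>k l s r i j. A i j r s k l) \<Lambda> x"
  shows "total_divergence U (\<lambda>\<Lambda> \<Omega> x. (\<Sum>i\<in>UNIV. \<Sum>j\<in>UNIV. \<Lambda> x $ i $ j * P \<Omega> x $ i $ j)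
                                - (\<Sum>i\<in>UNIV. \<Sum>j\<in>UNIV. Q \<Lambda> x $ i $ j * \<Omega> x $ i $ j))"
proof -
  define V where "V = (\<lambda>r (\<Lambda> :: real^'a \<Rightarrow> real^'a^'a) (\<Omega> :: real^'a \<Rightarrow> real^'a^'a) x.
    \<Sum>s\<in>UNIV. \<Sum>i\<in>UNIV. \<Sum>j\<in>UNIV. \<Sum>k\<in>UNIV. \<Sum>l\<in>UNIV.
      A i j r s k l * (\<Lambda> x $ i $ j * pd s (\<lambda>y. \<Omega> y $ k $ l) x)
      - A i j s r k l * (pd s (\<lambda>y. \<Lambda> y $ i $ j) x * \<Omega> x $ k $ l))"
  have "bidifferential_operator U (V r)" for r
  proof -
    \<comment> \<open>one of the two words is empty and the other is a single letter\<close>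
    define b where "b = (\<lambda>\<alpha> \<beta> i j k l (x :: real^'a). case (\<alpha>, \<beta>) of
      ([], [s]) \<Rightarrow> A i j r s k l | ([s], []) \<Rightarrow> - A i j s r k l | _ \<Rightarrow> 0)"
    have "smooth_on U (b \<alpha> \<beta> i j k l)" for \<alpha> \<beta> i j k l
      unfolding b_def using smooth_on_const[OF assms(1)] by (auto split: list.split)
    moreover have "V r \<Lambda> \<Omega> x = (\<Sum>\<alpha> | length \<alpha> \<le> 1. \<Sum>\<beta> | length \<beta> \<le> 1.
             \<Sum>i\<in>UNIV. \<Sum>j\<in>UNIV. \<Sum>k\<in>UNIV. \<Sum>l\<in>UNIV.
               b \<alpha> \<beta> i j k l x * iter_pd \<alpha> (\<lambda>y. \<Lambda> y $ i $ j) x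
                             * iter_pd \<beta> (\<lambda>y. \<Omega> y $ k $ l) x)" for \<Lambda> \<Omega> x
      unfolding sum_words_length_le_1
      by (simp add: b_def V_def sum.distrib sum_subtractf sum_negf mult.assoc)
    ultimately show ?thesis
      unfolding bidifferential_operator_def by blast
  qed
  moreover have "(\<Sum>i\<in>UNIV. \<Sum>j\<in>UNIV. \<Lambda> x $ i $ j * P \<Omega> x $ i $ j)
        - (\<Sum>i\<in>UNIV. \<Sum>j\<in>UNIV. Q \<Lambda> x $ i $ j * \<Omega> x $ i $ j) = (\<Sum>r\<in>UNIV. pd r (V r \<Lambda> \<Omega>) x)"
    if L: "\<Lambda> \<in> sym_fields U" and O: "\<Omega> \<in> sym_fields U" and x: "x \<in> U" for \<Lambda> \<Omega> x
  proof -
    have d: "(\<lambda>y. \<Lambda> y $ i $ j) differentiable at x" "pd r (\<lambda>y. \<Lambda> y $ i $ j) differentiable at x"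
      "(\<lambda>y. \<Omega> y $ i $ j) differentiable at x" "pd r (\<lambda>y. \<Omega> y $ i $ j) differentiable at x" for r i j
      using L O x smooth_on_sym_fields smooth_on_pd smooth_on_imp_differentiable by blast+
    let ?\<Lambda> = "\<lambda>i j y. \<Lambda> y $ i $ j" and ?\<Omega> = "\<lambda>i j y. \<Omega> y $ i $ j"
    \<comment> \<open>X and Y are the wanted second-order terms; the mixed terms Z cancel after exchanging r and s\<close>
    define X where "X = (\<lambda>r s. \<Sum>i\<in>UNIV. \<Sum>j\<in>UNIV. \<Sum>k\<in>UNIV. \<Sum>l\<in>UNIV.
      A i j r s k l * (\<Lambda> x $ i $ j * pd r (pd s (?\<Omega> k l)) x))"
    define Y where "Y = (\<lambda>r s. \<Sum>i\<in>UNIV. \<Sum>j\<in>UNIV. \<Sum>k\<in>UNIV. \<Sum>l\<in>UNIV.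
      A i j r s k l * (pd s (pd r (?\<Lambda> i j)) x * \<Omega> x $ k $ l))"
    define Z where "Z = (\<lambda>r s. \<Sum>i\<in>UNIV. \<Sum>j\<in>UNIV. \<Sum>k\<in>UNIV. \<Sum>l\<in>UNIV.
      A i j r s k l * (pd r (?\<Lambda> i j) x * pd s (?\<Omega> k l) x))"
    have V: "pd r (V r \<Lambda> \<Omega>) x = (\<Sum>s\<in>UNIV. (X r s + Z r s) - (Y s r + Z s r))" for r
    proof -
      have "pd r (V r \<Lambda> \<Omega>) x = (\<Sum>s\<in>UNIV. \<Sum>i\<in>UNIV. \<Sum>j\<in>UNIV. \<Sum>k\<in>UNIV. \<Sum>l\<in>UNIV.
        A i j r s k l * (\<Lambda> x $ i $ j * pd r (pd s (?\<Omega> k l)) x + pd r (?\<Lambda> i j) x * pd s (?\<Omega> k l) x)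
        - A i j s r k l * (pd s (?\<Lambda> i j) x * pd r (?\<Omega> k l) x + pd r (pd s (?\<Lambda> i j)) x * \<Omega> x $ k $ l))"
        unfolding V_def by (simp add: pd_sum pd_diff pd_cmult pd_mult d)
      then show ?thesis
        by (simp add: X_def Y_def Z_def sum.distrib sum_subtractf distrib_left)
    qed
    have "(\<Sum>r\<in>UNIV. pd r (V r \<Lambda> \<Omega>) x) = (\<Sum>r\<in>UNIV. \<Sum>s\<in>UNIV. X r s) - (\<Sum>r\<in>UNIV. \<Sum>s\<in>UNIV. Y r s)"
      using sum.swap[of "\<lambda>r s. Y s r" UNIV UNIV] sum.swap[of "\<lambda>r s. Z s r" UNIV UNIV]
      by (simp add: V sum.distrib sum_subtractf)
    moreover have "(\<Sum>i\<in>UNIV. \<Sum>j\<in>UNIV. \<Lambda> x $ i $ j * P \<Omega> x $ i $ j) = (\<Sum>r\<in>UNIV. \<Sum>s\<in>UNIV. X r s)"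
      unfolding X_def by (subst (1) sum_swap_pairs[symmetric])
        (simp add: P[OF O x] second_order_operator_def sum_distrib_left mult_ac)
    moreover have "(\<Sum>k\<in>UNIV. \<Sum>l\<in>UNIV. Q \<Lambda> x $ k $ l * \<Omega> x $ k $ l) = (\<Sum>r\<in>UNIV. \<Sum>s\<in>UNIV. Y r s)"
    proof -
      have "(\<Sum>k\<in>UNIV. \<Sum>l\<in>UNIV. Q \<Lambda> x $ k $ l * \<Omega> x $ k $ l) =
        (\<Sum>k\<in>UNIV. \<Sum>l\<in>UNIV. \<Sum>s\<in>UNIV. \<Sum>r\<in>UNIV. \<Sum>i\<in>UNIV. \<Sum>j\<in>UNIV.
          A i j r s k l * (pd s (pd r (?\<Lambda> i j)) x * \<Omega> x $ k $ l))"
        by (simp add: Q[OF L x] second_order_operator_def sum_distrib_left mult_ac)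
      also have "\<dots> = (\<Sum>s\<in>UNIV. \<Sum>r\<in>UNIV. \<Sum>k\<in>UNIV. \<Sum>l\<in>UNIV. \<Sum>i\<in>UNIV. \<Sum>j\<in>UNIV.
          A i j r s k l * (pd s (pd r (?\<Lambda> i j)) x * \<Omega> x $ k $ l))"
        by (rule sum_swap_pairs)
      also have "\<dots> = (\<Sum>s\<in>UNIV. \<Sum>r\<in>UNIV. Y r s)"
        unfolding Y_def by (intro sum.cong refl sum_swap_pairs)
      also have "\<dots> = (\<Sum>r\<in>UNIV. \<Sum>s\<in>UNIV. Y r s)"
        by (rule sum.swap)
      finally show ?thesis .
    qed
    ultimately show ?thesis by simp
  qed
  ultimately show ?thesis
    unfolding total_divergence_def by blast
qed

section \<open>The linearized Einstein operator of a constant metric\<close>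

lemma sum_kronecker2:
  fixes f :: "'n::finite \<Rightarrow> 'n \<Rightarrow> real"
  shows "(\<Sum>k\<in>UNIV. \<Sum>l\<in>UNIV. c k l * ((if i = k then 1 else 0) * (if j = l then 1 else 0)) * f k l) = c i j * f i j"
proof -
  have "(\<Sum>l\<in>UNIV. c k l * ((if i = k then 1 else 0) * (if j = l then 1 else 0)) * f k l)
      = (if i = k then c k j * f k j else 0)" for k
    by (cases "i = k") (simp_all add: if_distrib if_distribR cong: if_cong)
  then show ?thesis by simp
qed

lemma lower_indices_sym_fields:
  assumes "open U" "\<Lambda> \<in> sym_fields U"
  shows "lower_indices \<omega> \<Lambda> \<in> sym_fields U"
proof -
  have "lower_indices \<omega> \<Lambda> x $ i $ j = lower_indices \<omega> \<Lambda> x $ j $ i" if "x \<in> U" for x i j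
  proof -
    have "\<Lambda> x $ r $ s = \<Lambda> x $ s $ r" for r s
      using assms(2) that by (simp add: sym_fields_def)
    then have "lower_indices \<omega> \<Lambda> x $ i $ j
        = (\<Sum>r\<in>UNIV. \<Sum>s\<in>UNIV. \<omega> $ j $ s * \<omega> $ i $ r * \<Lambda> x $ s $ r)"
      by (simp add: lower_indices_def mult_ac)
    also have "\<dots> = lower_indices \<omega> \<Lambda> x $ j $ i"
      unfolding lower_indices_def vec_lambda_beta by (rule sum.swap)
    finally show ?thesis .
  qed
  moreover have "smooth_on U (\<lambda>x. lower_indices \<omega> \<Lambda> x $ i $ j)" for i j
    unfolding lower_indices_def vec_lambda_beta
    by (intro smooth_intros assms smooth_on_sym_fields)
  ultimately show ?thesis by (simp add: sym_fields_def)
qed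

lemma raise_indices_eq_lower_indices: "raise_indices \<omega> = lower_indices (matrix_inv \<omega>)"
  by (simp add: raise_indices_def lower_indices_def fun_eq_iff)

locale constant_metric =
  fixes \<omega> :: "real^'n::finite^'n"
  assumes symmetric: "transpose \<omega> = \<omega>" and invertible: "invertible \<omega>"
begin

abbreviation W where "W \<equiv> matrix_inv \<omega>"

lemma matrix_inv_inverse: "\<omega> ** W = mat 1" "W ** \<omega> = mat 1"
  using someI_ex[OF invertible[unfolded invertible_def]] by (simp_all add: matrix_inv_def)

lemma metric_commute: "\<omega> $ i $ j = \<omega> $ j $ i"
  using arg_cong[OF symmetric, of "\<lambda>M. M $ j $ i"] by (simp add: transpose_def)

lemma inverse_metric_commute: "W $ i $ j = W $ j $ i"
proof -
  have "transpose W ** \<omega> = mat 1"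
    using matrix_inv_inverse(1) symmetric
    by (metis matrix_transpose_mul transpose_mat)
  then have "transpose W = W"
    by (metis matrix_inv_inverse(1) matrix_mul_assoc matrix_mul_lid matrix_mul_rid)
  from arg_cong[OF this, of "\<lambda>M. M $ j $ i"] show ?thesis by (simp add: transpose_def)
qed

lemma metric_inverse_contract:
  "(\<Sum>k\<in>UNIV. \<omega> $ i $ k * W $ k $ j) = (if i = j then 1 else 0)"
  "(\<Sum>k\<in>UNIV. W $ i $ k * \<omega> $ k $ j) = (if i = j then 1 else 0)"
proof -
  have "(\<omega> ** W) $ i $ j = mat 1 $ i $ j" "(W ** \<omega>) $ i $ j = mat 1 $ i $ j"
    by (simp_all add: matrix_inv_inverse)
  then show "(\<Sum>k\<in>UNIV. \<omega> $ i $ k * W $ k $ j) = (if i = j then 1 else 0)"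
    "(\<Sum>k\<in>UNIV. W $ i $ k * \<omega> $ k $ j) = (if i = j then 1 else 0)"
    by (simp_all add: matrix_matrix_mult_def mat_def)
qed

text \<open>
  The coefficients of the linearized Einstein operator after its two free indices have been
  raised: the raised tensor is the sum of einstein_symbol i j r s k l times d_r d_s \<Omega>_{kl}. As \<Omega>
  is symmetric, many arrays represent this operator. Two choices make the present one exactly
  symmetric: in the term W^{rl} W^{ik} W^{js}, which comes from the contraction of d_{rj} \<Omega>_{si},
  the tensor indices of \<Omega> are exchanged, and so they are in the term W^{ks} W^{lr} W^{ij} of the
  scalar curvature, which then is the mirror image of W^{ir} W^{js} W^{kl}.
\<close>
definition einstein_symbol :: "'n \<Rightarrow> 'n \<Rightarrow> 'n \<Rightarrow> 'n \<Rightarrow> 'n \<Rightarrow> 'n \<Rightarrow> real" where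
  "einstein_symbol i j r s k l = 1/2 *
     (W$r$s * (W$i$k * W$j$l) + W$k$l * (W$i$r * W$j$s)
      - W$r$k * (W$i$s * W$j$l) - W$r$l * (W$i$k * W$j$s)
      - (W$r$s * W$k$l - W$k$s * W$l$r) * W$i$j)"

text \<open>
  The algebraic core of the self-adjointness. Under the exchange the second and the last of the six
  terms trade places, and each of the others is mapped to itself.
\<close>
lemma einstein_symbol_transpose: "einstein_symbol k l s r i j = einstein_symbol i j r s k l"
  unfolding einstein_symbol_def
  using inverse_metric_commute[of i k] inverse_metric_commute[of j l] inverse_metric_commute[of r s]
    inverse_metric_commute[of i s] inverse_metric_commute[of j s] inverse_metric_commute[of i r]
    inverse_metric_commute[of j r] inverse_metric_commute[of k r] inverse_metric_commute[of l r]
    inverse_metric_commute[of k s] inverse_metric_commute[of l s] inverse_metric_commute[of i l]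
    inverse_metric_commute[of j k]
  by (simp add: algebra_simps)

definition einstein_coeff :: "'n \<Rightarrow> 'n \<Rightarrow> 'n \<Rightarrow> 'n \<Rightarrow> 'n \<Rightarrow> 'n \<Rightarrow> real" where
  "einstein_coeff i j r s k l =
     (\<Sum>a\<in>UNIV. \<Sum>b\<in>UNIV. \<omega> $ i $ a * \<omega> $ j $ b * einstein_symbol a b r s k l)"

text \<open>
  Lowering the first two indices turns the inverse metrics that carry one of them into Kronecker
  deltas, and W^{ij} into the metric itself.
\<close>
lemma einstein_coeff_eq:
  "einstein_coeff i j r s k l = 1/2 *
     (W$r$s * ((if i = k then 1 else 0) * (if j = l then 1 else 0))
      + W$k$l * ((if i = r then 1 else 0) * (if j = s then 1 else 0))
      - W$r$k * ((if i = s then 1 else 0) * (if j = l then 1 else 0))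
      - W$r$l * ((if i = k then 1 else 0) * (if j = s then 1 else 0))
      - (W$r$s * W$k$l - W$k$s * W$l$r) * \<omega>$i$j)"
proof -
  \<comment> \<open>the lowering of two indices, as a linear functional on arrays\<close>
  define L where "L f = (\<Sum>a\<in>UNIV. \<Sum>b\<in>UNIV. \<omega> $ i $ a * \<omega> $ j $ b * f a b)" for f :: "'n \<Rightarrow> 'n \<Rightarrow> real"
  have lin: "L (\<lambda>a b. f a b + g a b) = L f + L g" "L (\<lambda>a b. f a b - g a b) = L f - L g"
    "L (\<lambda>a b. c * f a b) = c * L f" for f g c
    by (simp_all add: L_def sum.distrib sum_subtractf sum_distrib_left algebra_simps)
  have L2: "L (\<lambda>a b. W $ a $ k * W $ b $ l) = (if i = k then 1 else 0) * (if j = l then 1 else 0)" for k l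
  proof -
    have "L (\<lambda>a b. W $ a $ k * W $ b $ l) =
        (\<Sum>a\<in>UNIV. \<omega> $ i $ a * W $ a $ k) * (\<Sum>b\<in>UNIV. \<omega> $ j $ b * W $ b $ l)"
      by (simp add: L_def sum_product mult_ac)
    then show ?thesis by (simp only: metric_inverse_contract)
  qed
  have L1: "L (\<lambda>a b. W $ a $ b) = \<omega> $ i $ j"
  proof -
    have "L (\<lambda>a b. W $ a $ b) = (\<Sum>a\<in>UNIV. \<omega> $ i $ a * (\<Sum>b\<in>UNIV. \<omega> $ j $ b * W $ b $ a))"
      by (simp add: L_def sum_distrib_left inverse_metric_commute mult_ac)
    then show ?thesis by (simp add: metric_inverse_contract if_distrib cong: if_cong)
  qed
  have "einstein_coeff i j r s k l = L (\<lambda>a b. einstein_symbol a b r s k l)"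
    by (simp add: einstein_coeff_def L_def)
  also have "\<dots> = 1/2 *
     (W$r$s * ((if i = k then 1 else 0) * (if j = l then 1 else 0))
      + W$k$l * ((if i = r then 1 else 0) * (if j = s then 1 else 0))
      - W$r$k * ((if i = s then 1 else 0) * (if j = l then 1 else 0))
      - W$r$l * ((if i = k then 1 else 0) * (if j = s then 1 else 0))
      - (W$r$s * W$k$l - W$k$s * W$l$r) * \<omega>$i$j)"
    unfolding einstein_symbol_def lin L2 L1 ..
  finally show ?thesis .
qed

text \<open>
  The array D stands for the second derivatives of a symmetric tensor field at a point, and ric for
  the linearized Ricci tensor. X and Y are the two full contractions of D: the trace of ric is
  X - Y, because each of its four terms contributes half of one of them.
\<close>
lemma einstein_coeff_contract:
  fixes D :: "'n \<Rightarrow> 'n \<Rightarrow> 'n \<Rightarrow> 'n \<Rightarrow> real"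
  assumes D: "\<And>r s k l. D r s k l = D r s l k"
  defines "ric \<equiv> \<lambda>i j. 1/2 * ((\<Sum>r\<in>UNIV. \<Sum>s\<in>UNIV. W $ r $ s * D r s i j)
      + (\<Sum>r\<in>UNIV. \<Sum>s\<in>UNIV. W $ r $ s * D i j r s)
      - (\<Sum>r\<in>UNIV. \<Sum>s\<in>UNIV. W $ r $ s * (D r i s j + D r j s i)))"
  shows "(\<Sum>r\<in>UNIV. \<Sum>s\<in>UNIV. \<Sum>k\<in>UNIV. \<Sum>l\<in>UNIV. einstein_coeff i j r s k l * D r s k l)
      = ric i j - 1/2 * \<omega> $ i $ j * (\<Sum>a\<in>UNIV. \<Sum>b\<in>UNIV. W $ a $ b * ric a b)"
proof -
  let ?S = "\<lambda>f. \<Sum>r\<in>UNIV. \<Sum>s\<in>UNIV. \<Sum>k\<in>UNIV. \<Sum>l\<in>UNIV. f r s k l * D r s k l :: real"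
  let ?\<delta> = "\<lambda>a b. if a = b then 1 else 0 :: real"
  define X where "X = ?S (\<lambda>r s k l. W$r$s * W$k$l)"
  define Y where "Y = ?S (\<lambda>r s k l. W$k$s * W$l$r)"
  have S1: "?S (\<lambda>r s k l. W$r$s * (?\<delta> i k * ?\<delta> j l)) = (\<Sum>r\<in>UNIV. \<Sum>s\<in>UNIV. W$r$s * D r s i j)"
    by (simp only: sum_kronecker2)
  have S2: "?S (\<lambda>r s k l. W$k$l * (?\<delta> i r * ?\<delta> j s)) = (\<Sum>r\<in>UNIV. \<Sum>s\<in>UNIV. W$r$s * D i j r s)"
    by (subst sum_swap_pairs) (simp only: sum_kronecker2)
  have S3: "?S (\<lambda>r s k l. W$r$k * (?\<delta> i s * ?\<delta> j l)) = (\<Sum>r\<in>UNIV. \<Sum>s\<in>UNIV. W$r$s * D r i s j)"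
  proof (rule sum.cong[OF refl])
    fix r
    have "(\<Sum>s\<in>UNIV. \<Sum>k\<in>UNIV. \<Sum>l\<in>UNIV. W$r$k * (?\<delta> i s * ?\<delta> j l) * D r s k l)
        = (\<Sum>k\<in>UNIV. \<Sum>s\<in>UNIV. \<Sum>l\<in>UNIV. W$r$k * (?\<delta> i s * ?\<delta> j l) * D r s k l)"
      by (rule sum.swap)
    then show "(\<Sum>s\<in>UNIV. \<Sum>k\<in>UNIV. \<Sum>l\<in>UNIV. W$r$k * (?\<delta> i s * ?\<delta> j l) * D r s k l)
        = (\<Sum>k\<in>UNIV. W$r$k * D r i k j)"
      by (simp only: sum_kronecker2)
  qed
  have S4: "?S (\<lambda>r s k l. W$r$l * (?\<delta> i k * ?\<delta> j s)) = (\<Sum>r\<in>UNIV. \<Sum>s\<in>UNIV. W$r$s * D r j s i)"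
  proof (rule sum.cong[OF refl])
    fix r
    have "(\<Sum>s\<in>UNIV. \<Sum>k\<in>UNIV. \<Sum>l\<in>UNIV. W$r$l * (?\<delta> i k * ?\<delta> j s) * D r s k l)
        = (\<Sum>s\<in>UNIV. \<Sum>l\<in>UNIV. \<Sum>k\<in>UNIV. W$r$l * (?\<delta> j s * ?\<delta> i k) * D r s l k)"
      by (rule sum.cong[OF refl], subst sum.swap) (simp add: D[of r _ _ i] D mult_ac cong: if_cong)
    also have "\<dots> = (\<Sum>l\<in>UNIV. \<Sum>s\<in>UNIV. \<Sum>k\<in>UNIV. W$r$l * (?\<delta> j s * ?\<delta> i k) * D r s l k)"
      by (rule sum.swap)
    finally show "(\<Sum>s\<in>UNIV. \<Sum>k\<in>UNIV. \<Sum>l\<in>UNIV. W$r$l * (?\<delta> i k * ?\<delta> j s) * D r s k l)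
        = (\<Sum>l\<in>UNIV. W$r$l * D r j l i)"
      by (simp only: sum_kronecker2)
  qed
  have T1: "(\<Sum>a\<in>UNIV. \<Sum>b\<in>UNIV. W$a$b * (\<Sum>r\<in>UNIV. \<Sum>s\<in>UNIV. W$r$s * D r s a b)) = X"
    unfolding X_def by (subst sum_swap_pairs) (simp add: sum_distrib_left mult_ac)
  have T2: "(\<Sum>a\<in>UNIV. \<Sum>b\<in>UNIV. W$a$b * (\<Sum>r\<in>UNIV. \<Sum>s\<in>UNIV. W$r$s * D a b r s)) = X"
    unfolding X_def by (simp add: sum_distrib_left mult_ac)
  have T3: "(\<Sum>a\<in>UNIV. \<Sum>b\<in>UNIV. W$a$b * (\<Sum>r\<in>UNIV. \<Sum>s\<in>UNIV. W$r$s * D r a s b)) = Y"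
  proof -
    have "(\<Sum>a\<in>UNIV. \<Sum>b\<in>UNIV. W$a$b * (\<Sum>r\<in>UNIV. \<Sum>s\<in>UNIV. W$r$s * D r a s b))
        = (\<Sum>a\<in>UNIV. \<Sum>b\<in>UNIV. \<Sum>r\<in>UNIV. \<Sum>s\<in>UNIV. W$b$a * W$s$r * D r a b s)"
      using D inverse_metric_commute by (simp add: sum_distrib_left mult_ac)
    also have "\<dots> = (\<Sum>a\<in>UNIV. \<Sum>r\<in>UNIV. \<Sum>b\<in>UNIV. \<Sum>s\<in>UNIV. W$b$a * W$s$r * D r a b s)"
      by (intro sum.cong refl sum.swap)
    also have "\<dots> = Y"
      unfolding Y_def by (rule sum.swap)
    finally show ?thesis .
  qed
  have T4: "(\<Sum>a\<in>UNIV. \<Sum>b\<in>UNIV. W$a$b * (\<Sum>r\<in>UNIV. \<Sum>s\<in>UNIV. W$r$s * D r b s a)) = Y"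
    unfolding T3[symmetric] by (subst sum.swap) (simp only: inverse_metric_commute)
  have tr: "(\<Sum>a\<in>UNIV. \<Sum>b\<in>UNIV. W $ a $ b * ric a b) = X - Y"
  proof -
    have "(\<Sum>a\<in>UNIV. \<Sum>b\<in>UNIV. W $ a $ b * ric a b) = 1/2 * (X + X - (Y + Y))"
      unfolding ric_def
      by (subst (1) T1[symmetric], subst (1) T2[symmetric], subst (1) T3[symmetric], subst (1) T4[symmetric])
        (simp add: sum.distrib sum_subtractf sum_distrib_left distrib_left right_diff_distrib mult_ac)
    then show ?thesis by simp
  qed
  have "?S (einstein_coeff i j) = 1/2 * (?S (\<lambda>r s k l. W$r$s * (?\<delta> i k * ?\<delta> j l))
      + ?S (\<lambda>r s k l. W$k$l * (?\<delta> i r * ?\<delta> j s)) - ?S (\<lambda>r s k l. W$r$k * (?\<delta> i s * ?\<delta> j l))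
      - ?S (\<lambda>r s k l. W$r$l * (?\<delta> i k * ?\<delta> j s)) - (X - Y) * \<omega>$i$j)"
    unfolding einstein_coeff_eq X_def Y_def
    by (simp only: sum.distrib sum_subtractf sum_distrib_left sum_distrib_right
        distrib_left distrib_right left_diff_distrib right_diff_distrib mult.assoc mult.commute[of _ "\<omega>$i$j"])
  then show ?thesis
    unfolding S1 S2 S3 S4 tr
    by (simp add: ric_def sum.distrib distrib_left algebra_simps diff_divide_distrib)
qed

lemma pd_tr:
  assumes "\<Omega> \<in> sym_fields U" "x \<in> U"
  shows "pd j (tr \<omega> \<Omega>) x = (\<Sum>r\<in>UNIV. \<Sum>s\<in>UNIV. W $ r $ s * pd j (\<lambda>y. \<Omega> y $ r $ s) x)"
proof -
  have "(\<lambda>y. \<Omega> y $ r $ s) differentiable at x" for r s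
    using assms smooth_on_sym_fields smooth_on_imp_differentiable by blast
  then show ?thesis
    unfolding tr_def[abs_def] by (simp add: pd_sum pd_cmult)
qed

lemma pd_pd_tr:
  assumes "open U" "\<Omega> \<in> sym_fields U" "x \<in> U"
  shows "pd i (pd j (tr \<omega> \<Omega>)) x
    = (\<Sum>r\<in>UNIV. \<Sum>s\<in>UNIV. W $ r $ s * pd i (pd j (\<lambda>y. \<Omega> y $ r $ s)) x)"
proof -
  have "pd j (\<lambda>y. \<Omega> y $ r $ s) differentiable at x" for r s
    using assms smooth_on_sym_fields smooth_on_pd smooth_on_imp_differentiable by blast
  then show ?thesis
    using pd_cong_open[OF assms(1,3) pd_tr[OF assms(2)], where i = i] by (simp add: pd_sum pd_cmult)
qed

lemma linearized_einstein_eq_second_order: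
  assumes "open U" "\<Omega> \<in> sym_fields U" "x \<in> U"
  shows "linearized_einstein \<omega> \<Omega> x = second_order_operator einstein_coeff \<Omega> x"
proof -
  define D where "D r s k l = pd r (pd s (\<lambda>y. \<Omega> y $ k $ l)) x" for r s k l
  have D: "D r s k l = D r s l k" for r s k l
  proof -
    have "pd s (\<lambda>y. \<Omega> y $ k $ l) y = pd s (\<lambda>y. \<Omega> y $ l $ k) y" if "y \<in> U" for y
      by (rule pd_cong_open[OF assms(1) that]) (use assms(2) in \<open>simp add: sym_fields_def\<close>)
    then show ?thesis
      unfolding D_def by (rule pd_cong_open[OF assms(1,3)])
  qed
  show ?thesis
    using einstein_coeff_contract[OF D]
    by (simp add: vec_eq_iff linearized_einstein_def linearized_ricci_def second_order_operator_def
        pd_pd_tr[OF assms] tr_def[of \<omega> "linearized_ricci \<omega> \<Omega>"] flip: D_def)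
qed

text \<open>
  The Hessian of the trace is the one term of the Ricci tensor whose symmetry needs commuting
  derivatives; the others are symmetric by inspection.
\<close>
lemma linearized_einstein_sym_fields:
  assumes "open U" "\<Omega> \<in> sym_fields U"
  shows "linearized_einstein \<omega> \<Omega> \<in> sym_fields U"
proof -
  have "smooth_on U (\<lambda>x. linearized_einstein \<omega> \<Omega> x $ i $ j)" for i j
    using smooth_on_second_order_operator[OF assms, of einstein_coeff i j]
      smooth_on_cong[OF assms(1), of "\<lambda>x. linearized_einstein \<omega> \<Omega> x $ i $ j"]
    by (simp add: linearized_einstein_eq_second_order[OF assms])
  moreover have "linearized_einstein \<omega> \<Omega> x $ i $ j = linearized_einstein \<omega> \<Omega> x $ j $ i"
    if "x \<in> U" for x i j
  proof -
    have "pd r (pd s (\<lambda>y. \<Omega> y $ i $ j)) x = pd r (pd s (\<lambda>y. \<Omega> y $ j $ i)) x" for r s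
    proof -
      have "pd s (\<lambda>y. \<Omega> y $ i $ j) y = pd s (\<lambda>y. \<Omega> y $ j $ i) y" if "y \<in> U" for y
        by (rule pd_cong_open[OF assms(1) that]) (use assms(2) in \<open>simp add: sym_fields_def\<close>)
      then show ?thesis by (rule pd_cong_open[OF assms(1) that])
    qed
    moreover have "pd i (pd j (tr \<omega> \<Omega>)) x = pd j (pd i (tr \<omega> \<Omega>)) x"
      unfolding pd_pd_tr[OF assms that]
      by (simp only: pd_commute[OF assms(1) smooth_on_sym_fields[OF assms(2)] that, of i j])
    ultimately have "linearized_ricci \<omega> \<Omega> x $ i $ j = linearized_ricci \<omega> \<Omega> x $ j $ i"
      by (simp add: linearized_ricci_def add.commute)
    then show ?thesis
      by (simp add: linearized_einstein_def metric_commute[of i j])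
  qed
  ultimately show ?thesis by (simp add: sym_fields_def)
qed

lemma raise_einstein_coeff:
  "(\<Sum>i\<in>UNIV. \<Sum>j\<in>UNIV. W $ p $ i * W $ q $ j * einstein_coeff i j r s k l)
    = einstein_symbol p q r s k l"
proof -
  let ?E = "\<lambda>a b. einstein_symbol a b r s k l"
  have "(\<Sum>i\<in>UNIV. \<Sum>j\<in>UNIV. W $ p $ i * W $ q $ j * einstein_coeff i j r s k l)
      = (\<Sum>i\<in>UNIV. \<Sum>j\<in>UNIV. \<Sum>a\<in>UNIV. \<Sum>b\<in>UNIV.
          (W $ p $ i * \<omega> $ i $ a) * (W $ q $ j * \<omega> $ j $ b) * ?E a b)"
    by (simp add: einstein_coeff_def sum_distrib_left mult_ac)
  also have "\<dots> = (\<Sum>a\<in>UNIV. \<Sum>b\<in>UNIV. \<Sum>i\<in>UNIV. \<Sum>j\<in>UNIV.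
          (W $ p $ i * \<omega> $ i $ a) * (W $ q $ j * \<omega> $ j $ b) * ?E a b)"
    by (rule sum_swap_pairs)
  also have "\<dots> = (\<Sum>a\<in>UNIV. \<Sum>b\<in>UNIV. 1 *
      ((\<Sum>i\<in>UNIV. W $ p $ i * \<omega> $ i $ a) * (\<Sum>j\<in>UNIV. W $ q $ j * \<omega> $ j $ b)) * ?E a b)"
    unfolding sum_product by (simp add: sum_distrib_right)
  also have "\<dots> = ?E p q"
    unfolding metric_inverse_contract sum_kronecker2 by simp
  finally show ?thesis .
qed

lemma lower_einstein_symbol:
  "(\<Sum>k\<in>UNIV. \<Sum>l\<in>UNIV. einstein_symbol p q r s k l * (\<omega> $ k $ a * \<omega> $ l $ b))
    = einstein_coeff a b s r p q"
  unfolding einstein_coeff_def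
  by (simp add: einstein_symbol_transpose[of _ _ s r p q] metric_commute[of a] metric_commute[of b] mult_ac)

text \<open>
  Raising the free indices turns einstein_coeff into einstein_symbol. The metric that lowers the
  argument then contracts the last two indices of einstein_symbol, which by its symmetry gives
  einstein_coeff with the two pairs of tensor indices exchanged and the derivatives reversed: the
  coefficients of the formal adjoint in total_divergence_second_order.
\<close>
lemma raise_einstein_lower_eq_second_order:
  assumes "open U" "\<Lambda> \<in> sym_fields U" "x \<in> U"
  shows "raise_indices \<omega> (linearized_einstein \<omega> (lower_indices \<omega> \<Lambda>)) x
    = second_order_operator (\<lambda>k l s r i j. einstein_coeff i j r s k l) \<Lambda> x"
proof -
  define D where "D r s k l = pd r (pd s (\<lambda>y. \<Lambda> y $ k $ l)) x" for r s k l
  define L where "L r s k l = (\<Sum>a\<in>UNIV. \<Sum>b\<in>UNIV. \<omega> $ k $ a * \<omega> $ l $ b * D r s a b)" for r s k l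
  have L: "pd r (pd s (\<lambda>y. lower_indices \<omega> \<Lambda> y $ k $ l)) x = L r s k l" for r s k l
  proof -
    have d: "(\<lambda>y. \<Lambda> y $ k $ l) differentiable at y" "pd s (\<lambda>y. \<Lambda> y $ k $ l) differentiable at y"
      if "y \<in> U" for y k l
      using assms(2) that smooth_on_sym_fields smooth_on_pd smooth_on_imp_differentiable by blast+
    have "pd s (\<lambda>y. lower_indices \<omega> \<Lambda> y $ k $ l) y
        = (\<Sum>a\<in>UNIV. \<Sum>b\<in>UNIV. \<omega> $ k $ a * \<omega> $ l $ b * pd s (\<lambda>y. \<Lambda> y $ a $ b) y)" if "y \<in> U" for y
      by (simp add: lower_indices_def pd_sum pd_cmult d that)
    from pd_cong_open[OF assms(1,3) this, where i = r] show ?thesis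
      by (simp add: L_def D_def pd_sum pd_cmult d assms(3))
  qed
  have "raise_indices \<omega> (linearized_einstein \<omega> (lower_indices \<omega> \<Lambda>)) x $ p $ q
    = second_order_operator (\<lambda>k l s r i j. einstein_coeff i j r s k l) \<Lambda> x $ p $ q" for p q
  proof -
    have "raise_indices \<omega> (linearized_einstein \<omega> (lower_indices \<omega> \<Lambda>)) x $ p $ q
       = (\<Sum>i\<in>UNIV. \<Sum>j\<in>UNIV. \<Sum>r\<in>UNIV. \<Sum>s\<in>UNIV. \<Sum>k\<in>UNIV. \<Sum>l\<in>UNIV.
            W $ p $ i * W $ q $ j * einstein_coeff i j r s k l * L r s k l)"
      using linearized_einstein_eq_second_order[OF assms(1) lower_indices_sym_fields[OF assms(1,2)] assms(3)]
      by (simp add: raise_indices_def second_order_operator_def L sum_distrib_left mult_ac)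
    also have "\<dots> = (\<Sum>r\<in>UNIV. \<Sum>s\<in>UNIV. \<Sum>i\<in>UNIV. \<Sum>j\<in>UNIV. \<Sum>k\<in>UNIV. \<Sum>l\<in>UNIV.
            W $ p $ i * W $ q $ j * einstein_coeff i j r s k l * L r s k l)"
      by (rule sum_swap_pairs)
    also have "\<dots> = (\<Sum>r\<in>UNIV. \<Sum>s\<in>UNIV. \<Sum>k\<in>UNIV. \<Sum>l\<in>UNIV. \<Sum>i\<in>UNIV. \<Sum>j\<in>UNIV.
            W $ p $ i * W $ q $ j * einstein_coeff i j r s k l * L r s k l)"
      by (intro sum.cong refl sum_swap_pairs)
    also have "\<dots> = (\<Sum>r\<in>UNIV. \<Sum>s\<in>UNIV. \<Sum>k\<in>UNIV. \<Sum>l\<in>UNIV. einstein_symbol p q r s k l * L r s k l)"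
      by (simp add: sum_distrib_right flip: raise_einstein_coeff)
    also have "\<dots> = (\<Sum>r\<in>UNIV. \<Sum>s\<in>UNIV. \<Sum>k\<in>UNIV. \<Sum>l\<in>UNIV. \<Sum>a\<in>UNIV. \<Sum>b\<in>UNIV.
            einstein_symbol p q r s k l * (\<omega> $ k $ a * \<omega> $ l $ b) * D r s a b)"
      by (simp add: L_def sum_distrib_left mult_ac)
    also have "\<dots> = (\<Sum>r\<in>UNIV. \<Sum>s\<in>UNIV. \<Sum>a\<in>UNIV. \<Sum>b\<in>UNIV. \<Sum>k\<in>UNIV. \<Sum>l\<in>UNIV.
            einstein_symbol p q r s k l * (\<omega> $ k $ a * \<omega> $ l $ b) * D r s a b)"
      by (intro sum.cong refl sum_swap_pairs)
    also have "\<dots> = (\<Sum>r\<in>UNIV. \<Sum>s\<in>UNIV. \<Sum>a\<in>UNIV. \<Sum>b\<in>UNIV. einstein_coeff a b s r p q * D r s a b)"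
      by (simp add: sum_distrib_right flip: lower_einstein_symbol)
    finally show ?thesis
      by (simp add: second_order_operator_def D_def)
  qed
  then show ?thesis by (simp add: vec_eq_iff)
qed

lemma is_formal_adjoint_einstein:
  assumes "open U"
  shows "is_formal_adjoint U (linearized_einstein \<omega>)
    (\<lambda>\<Lambda> x. if \<Lambda> \<in> sym_fields U \<and> x \<in> U
      then raise_indices \<omega> (linearized_einstein \<omega> (lower_indices \<omega> \<Lambda>)) x else 0)"
    (is "is_formal_adjoint U _ ?Q")
proof -
  have Q: "?Q \<Lambda> x = second_order_operator (\<lambda>k l s r i j. einstein_coeff i j r s k l) \<Lambda> x"
    if "\<Lambda> \<in> sym_fields U" "x \<in> U" for \<Lambda> x
    using that raise_einstein_lower_eq_second_order[OF assms] by simp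
  have "?Q \<Lambda> \<in> sym_fields U" if \<Lambda>: "\<Lambda> \<in> sym_fields U" for \<Lambda>
  proof -
    have "raise_indices \<omega> (linearized_einstein \<omega> (lower_indices \<omega> \<Lambda>)) \<in> sym_fields U"
      unfolding raise_indices_eq_lower_indices
      by (intro lower_indices_sym_fields linearized_einstein_sym_fields assms \<Lambda>)
    then show ?thesis
      using smooth_on_cong[OF assms, of "\<lambda>x. ?Q \<Lambda> x $ i $ j"
          "\<lambda>x. raise_indices \<omega> (linearized_einstein \<omega> (lower_indices \<omega> \<Lambda>)) x $ i $ j" for i j] \<Lambda>
      by (simp add: sym_fields_def)
  qed
  then have "differential_operator U ?Q"
    using Q by (rule differential_operator_second_order[OF assms])
  moreover have "total_divergence U (\<lambda>\<Lambda> \<Omega> x.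
      (\<Sum>i\<in>UNIV. \<Sum>j\<in>UNIV. \<Lambda> x $ i $ j * linearized_einstein \<omega> \<Omega> x $ i $ j)
      - (\<Sum>i\<in>UNIV. \<Sum>j\<in>UNIV. ?Q \<Lambda> x $ i $ j * \<Omega> x $ i $ j))"
    using linearized_einstein_eq_second_order[OF assms] Q
    by (rule total_divergence_second_order[OF assms])
  ultimately show ?thesis
    by (simp add: is_formal_adjoint_def)
qed

end

section \<open>The Minkowski metric\<close>

lemma constant_metric_minkowski:
  assumes "minkowski_metric \<omega>"
  shows "constant_metric \<omega>"
proof -
  obtain \<tau> and \<epsilon> :: real where \<epsilon>: "\<epsilon> \<in> {1, -1}"
    and \<omega>: "\<omega> = (\<chi> i j. if i \<noteq> j then 0 else if i = \<tau> then - \<epsilon> else \<epsilon>)"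
    using assms unfolding minkowski_metric_def by blast
  have "transpose \<omega> = \<omega>"
    by (auto simp: \<omega> transpose_def vec_eq_iff)
  moreover have "\<omega> ** \<omega> = mat 1"
  proof -
    have "(\<Sum>k\<in>UNIV. \<omega> $ i $ k * \<omega> $ k $ j) = (if i = j then 1 else 0)" for i j
    proof -
      have "(\<Sum>k\<in>UNIV. \<omega> $ i $ k * \<omega> $ k $ j) = (\<Sum>k\<in>UNIV. if k = i then \<omega> $ i $ i * \<omega> $ i $ j else 0)"
        by (rule sum.cong) (auto simp: \<omega>)
      also have "\<dots> = \<omega> $ i $ i * \<omega> $ i $ j" by simp
      also have "\<dots> = (if i = j then 1 else 0)" using \<epsilon> by (auto simp: \<omega>)
      finally show ?thesis .
    qed
    then show ?thesis by (simp add: matrix_matrix_mult_def mat_def vec_eq_iff)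
  qed
  then have "invertible \<omega>" unfolding invertible_def by blast
  ultimately show ?thesis by (rule constant_metric.intro)
qed

theorem theorem3p9:
  fixes \<omega> :: "real^'n::finite^'n" and U :: "(real^'n) set"
  assumes "minkowski_metric \<omega>" and "open U"
  shows "(\<exists>!Q. is_formal_adjoint U (linearized_einstein \<omega>) Q) \<and>
         (\<forall>\<Lambda>\<in>sym_fields U. \<forall>x\<in>U.
            formal_adjoint U (linearized_einstein \<omega>) \<Lambda> x =
              raise_indices \<omega> (linearized_einstein \<omega> (lower_indices \<omega> \<Lambda>)) x)"
proof -
  interpret constant_metric \<omega>
    using assms(1) by (rule constant_metric_minkowski)
  let ?Q = "\<lambda>\<Lambda> x. if \<Lambda> \<in> sym_fields U \<and> x \<in> U
      then raise_indices \<omega> (linearized_einstein \<omega> (lower_indices \<omega> \<Lambda>)) x else 0"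
  have adj: "is_formal_adjoint U (linearized_einstein \<omega>) ?Q"
    using assms(2) by (rule is_formal_adjoint_einstein)
  have unique: "Q = ?Q" if "is_formal_adjoint U (linearized_einstein \<omega>) Q" for Q
    using assms(2) that adj by (rule is_formal_adjoint_unique)
  have "formal_adjoint U (linearized_einstein \<omega>) = ?Q"
    unfolding formal_adjoint_def using adj unique by (rule the_equality)
  moreover have "\<exists>!Q. is_formal_adjoint U (linearized_einstein \<omega>) Q"
    using adj unique by (rule ex1I)
  ultimately show ?thesis by simp
qed

end
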